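(* Let $k$ be a positive integer and $n, m$ integers with $m > \frac{n}{2}$, and set $\ell := n-k-m+\frac{23}{24}$. Suppose $\ell > 16$. Then there exist real numbers $\theta_1,\theta_2$ with $|\theta_1| \leq \frac{2079}{\ell}$ and $|\theta_2| \leq \frac{3929}{\ell}$ such that \[ \frac{N_k(m,n) - N_k(m+1,n)}{p(n-k-m+1)} = 1+ e^{-\frac{\sqrt{2}\pi}{\sqrt{3\ell}}} \left( 1 + \theta_1\right) - e^{-\frac{\pi}{\sqrt{6\ell}}} \left( 2 + \theta_2 \right). \]
   Context: $p(r)$ denotes the number of partitions of the nonnegative integer $r$ ($p(0)=1$). $N_k(m,n)$ is Garvan's $k$-rank count: for $k\ge 2$, for a partition with at least $k-1$ successive Durfee squares (the first Durfee square is the largest square fitting in the top-left of the Ferrers diagram, the next is the Durfee square of the partition formed by the parts below the previous one, etc.) of side lengths $n_1, \dots, n_{k-1}$, its $k$-rank is the number of columns of the Ferrers diagram lying to the right of the first Durfee square whose length is at most $n_{k-1}$, minus the number of parts lying below the $(k-1)$-th Durfee square; $N_k(m,n)$ is the number of partitions of $n$ with at least $k-1$ successive Durfee squares whose $k$-rank equals $m$. For $k=1$, $N_1(m,n)$ is the number of partitions of $n$ whose Andrews–Garvan crank equals $m$. It is known (Garvan) that for $m > \frac{n}{2}$ one has $N_k(m,n) = p(n-k-m+1) - p(n-k-m)$. *)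

theory Defs
  imports Complex_Main
begin

text \<open>A partition is the weakly decreasing list of its (positive) parts.
  The argument is an integer; there are no partitions of a negative number.\<close>

definition partitions_of :: "int \<Rightarrow> nat list set" where
  "partitions_of n = {xs. sorted_wrt (\<ge>) xs \<and> 0 \<notin> set xs \<and> int (sum_list xs) = n}"

definition num_partitions :: "int \<Rightarrow> nat" where
  "num_partitions n = card (partitions_of n)"

text \<open>Rows and columns of the Ferrers diagram are indexed from 0.\<close>

definition ferrers :: "nat list \<Rightarrow> (nat \<times> nat) set" where
  "ferrers xs = {(i, j). i < length xs \<and> j < xs ! i}"

definition column_length :: "nat list \<Rightarrow> nat \<Rightarrow> nat" where
  "column_length xs j = card {i. (i, j) \<in> ferrers xs}"

definition durfee :: "nat list \<Rightarrow> nat" where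
  "durfee xs = Max {d. {..<d} \<times> {..<d} \<subseteq> ferrers xs}"

definition below_durfee :: "nat \<Rightarrow> nat list \<Rightarrow> nat list" where
  "below_durfee j = (\<lambda>xs. drop (durfee xs) xs) ^^ j"

text \<open>The successive Durfee squares are indexed from 1, so that \<open>durfee_side j xs\<close> is the
  side length \<open>n\<^sub>j\<close>. It is 0 if there is no \<open>j\<close>-th square.\<close>

definition durfee_side :: "nat \<Rightarrow> nat list \<Rightarrow> nat" where
  "durfee_side j xs = durfee (below_durfee (j - 1) xs)"

definition has_durfee_squares :: "nat \<Rightarrow> nat list \<Rightarrow> bool" where
  "has_durfee_squares j xs \<longleftrightarrow> (\<forall>i\<in>{1..j}. durfee_side i xs > 0)"

text \<open>The \<open>k\<close>-rank, meaningful for \<open>k \<ge> 2\<close> and partitions with at least \<open>k - 1\<close> successive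
  Durfee squares.\<close>

definition k_rank :: "nat \<Rightarrow> nat list \<Rightarrow> int" where
  "k_rank k xs =
     int (card {j \<in> snd ` ferrers xs.
                  durfee_side 1 xs \<le> j \<and> column_length xs j \<le> durfee_side (k - 1) xs})
     - int (length (below_durfee (k - 1) xs))"

text \<open>The Andrews--Garvan crank: the largest part if 1 is not a part, and otherwise the number
  of parts exceeding the number \<open>\<omega>\<close> of ones, minus \<open>\<omega>\<close>. The empty partition gets crank 0.\<close>

definition crank :: "nat list \<Rightarrow> int" where
  "crank xs = (let \<omega> = count_list xs 1 in
     if \<omega> = 0 then int (Max (insert 0 (set xs)))
     else int (length (filter (\<lambda>x. x > \<omega>) xs)) - int \<omega>)"

definition rank_count :: "nat \<Rightarrow> int \<Rightarrow> int \<Rightarrow> nat" where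
  "rank_count k m n =
     (if k = 1 then card {xs \<in> partitions_of n. crank xs = m}
      else card {xs \<in> partitions_of n. has_durfee_squares (k - 1) xs \<and> k_rank k xs = m})"

end

theory Submission
  imports Defs "HOL-Computational_Algebra.Formal_Power_Series"
begin

text \<open>
  Put \<open>r = n - k - m + 1\<close>, so that \<open>l = r - 1/24\<close>.

  Garvan's formula \<open>N\<^sub>k(m,n) = p(r) - p(r-1)\<close> for \<open>2m > n\<close>: let \<open>N\<close> be the side of the last required
  Durfee square and \<open>b\<close> the number of parts below it. Replacing the first row of a partition of
  \<open>k\<close>-rank \<open>m\<close> by a row below the top \<open>N - 1\<close> remaining ones, of the least admissible length,
  removes \<open>m + b\<close> cells. This shows that \<open>N\<^sub>k(m,n)\<close> is the coefficient of \<open>q\<^sup>n\<^sup>-\<^sup>m\<close> in the sum of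
  \<open>q\<^bsup>|\<mu>|+b\<^esup>(1 - q\<^sup>N)\<close> over all \<open>\<mu>\<close> having the required Durfee squares. Splitting off one Durfee square at
  a time, an identity of Durfee rectangle type shows that each further square multiplies this series
  by \<open>q\<close>.

  The quotient in question is therefore \<open>\<Delta>\<^sup>2p(r)/p(r)\<close>, and the claim only says that it differs from
  \<open>(1 - exp(-\<pi>/\<surd>(6l)))\<^sup>2\<close> by at most a large multiple of \<open>1/l\<close>. Both are of order \<open>1/l\<close>; for the quotient,
  \<open>0 \<le> \<Delta>\<^sup>2p(r) \<le> 12 p(r)/r\<close>. Here \<open>\<Delta>\<^sup>2p(r)\<close> is at most the number \<open>f(r)\<close> of partitions into parts
  \<open>\<ge> 3\<close>. Logarithmic differentiation gives \<open>r f(r) = \<Sum> \<sigma>(j) f(r-j)\<close>, where \<open>\<sigma>(j)\<close> sums the divisors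
  \<open>\<ge> 3\<close> of \<open>j\<close>. As \<open>f\<close> is essentially monotone and \<open>\<sigma>(j)\<close> is on average at most \<open>2j\<close>, the right hand
  side is essentially bounded by \<open>2 \<Sum> j f(r-j)\<close>, hence by \<open>4 p(r)\<close>.
\<close>

unbundle fps_syntax

section \<open>Generating functions of weighted sets\<close>

definition gf :: "'a set \<Rightarrow> ('a \<Rightarrow> nat) \<Rightarrow> int fps" where
  "gf S w = Abs_fps (\<lambda>n. int (card {x \<in> S. w x = n}))"

text \<open>This guards the rules for \<open>gf\<close>: \<open>card\<close> is 0 on infinite sets,
  which would falsify sums and products.\<close>

definition finite_fibres :: "'a set \<Rightarrow> ('a \<Rightarrow> nat) \<Rightarrow> bool" where
  "finite_fibres S w \<longleftrightarrow> (\<forall>n. finite {x \<in> S. w x = n})"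

lemma gf_nth: "gf S w $ n = int (card {x \<in> S. w x = n})"
  by (simp add: gf_def)

lemma finite_fibres_subset: "finite_fibres T w \<Longrightarrow> S \<subseteq> T \<Longrightarrow> finite_fibres S w"
proof -
  assume T: "finite_fibres T w" "S \<subseteq> T"
  have "{x \<in> S. w x = n} \<subseteq> {x \<in> T. w x = n}" for n using T(2) by blast
  with T(1) show ?thesis unfolding finite_fibres_def by (meson finite_subset)
qed

lemma finite_fibres_mono:
  assumes "finite_fibres S w" "\<And>x. x \<in> S \<Longrightarrow> w x \<le> w' x"
  shows "finite_fibres S w'"
  unfolding finite_fibres_def
proof
  fix n
  have "{x \<in> S. w' x = n} \<subseteq> (\<Union>i\<le>n. {x \<in> S. w x = i})"
    using assms(2) by fastforce
  then show "finite {x \<in> S. w' x = n}"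
    by (rule finite_subset) (use assms(1) in \<open>auto simp: finite_fibres_def\<close>)
qed

lemma gf_Un:
  assumes "finite_fibres A w" "finite_fibres B w" "A \<inter> B = {}"
  shows "gf (A \<union> B) w = gf A w + gf B w"
proof (rule fps_ext)
  fix n
  have "{x \<in> A \<union> B. w x = n} = {x \<in> A. w x = n} \<union> {x \<in> B. w x = n}" by auto
  moreover have "card ({x \<in> A. w x = n} \<union> {x \<in> B. w x = n})
      = card {x \<in> A. w x = n} + card {x \<in> B. w x = n}"
    using assms by (intro card_Un_disjoint) (auto simp: finite_fibres_def)
  ultimately show "gf (A \<union> B) w $ n = (gf A w + gf B w) $ n"
    by (simp add: gf_nth)
qed

lemma gf_UN:
  assumes "finite I" "\<And>i. i \<in> I \<Longrightarrow> finite_fibres (A i) w"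
    "\<And>i j x. i \<in> I \<Longrightarrow> j \<in> I \<Longrightarrow> x \<in> A i \<Longrightarrow> x \<in> A j \<Longrightarrow> i = j"
  shows "gf (\<Union>i\<in>I. A i) w = (\<Sum>i\<in>I. gf (A i) w)"
proof (rule fps_ext)
  fix n
  have "{x \<in> (\<Union>i\<in>I. A i). w x = n} = (\<Union>i\<in>I. {x \<in> A i. w x = n})" by auto
  moreover have "card (\<Union>i\<in>I. {x \<in> A i. w x = n}) = (\<Sum>i\<in>I. card {x \<in> A i. w x = n})"
  proof (rule card_UN_disjoint)
    show "\<forall>i\<in>I. finite {x \<in> A i. w x = n}"
      using assms(2) by (simp add: finite_fibres_def)
    show "\<forall>i\<in>I. \<forall>j\<in>I. i \<noteq> j \<longrightarrow> {x \<in> A i. w x = n} \<inter> {x \<in> A j. w x = n} = {}"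
      using assms(3) by blast
  qed (rule assms(1))
  ultimately show "gf (\<Union>i\<in>I. A i) w $ n = (\<Sum>i\<in>I. gf (A i) w) $ n"
    by (simp add: gf_nth fps_sum_nth)
qed

lemma gf_image:
  assumes "inj_on h A" "\<And>x. x \<in> A \<Longrightarrow> w' (h x) = w x + c"
  shows "gf (h ` A) w' = fps_X ^ c * gf A w"
proof (rule fps_ext)
  fix n
  have *: "{y \<in> h ` A. w' y = n} = h ` {x \<in> A. w x + c = n}"
    using assms(2) by auto
  have "card {y \<in> h ` A. w' y = n} = card {x \<in> A. w x + c = n}"
    unfolding * by (rule card_image) (use assms(1) in \<open>auto simp: inj_on_def\<close>)
  moreover have "{x \<in> A. w x + c = n} = (if n < c then {} else {x \<in> A. w x = n - c})"
    by auto
  ultimately show "gf (h ` A) w' $ n = (fps_X ^ c * gf A w) $ n"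
    by (simp add: gf_nth fps_X_power_mult_nth)
qed

lemma gf_Times:
  assumes "finite_fibres A u" "finite_fibres B v"
  shows "gf (A \<times> B) (\<lambda>(x, y). u x + v y) = gf A u * gf B v"
proof (rule fps_ext)
  fix n
  have "{p \<in> A \<times> B. (case p of (x, y) \<Rightarrow> u x + v y) = n}
      = (\<Union>i\<in>{0..n}. {x \<in> A. u x = i} \<times> {y \<in> B. v y = n - i})" (is "?L = ?R")
    by force
  moreover have "card ?R = (\<Sum>i\<in>{0..n}. card ({x \<in> A. u x = i} \<times> {y \<in> B. v y = n - i}))"
    using assms by (intro card_UN_disjoint) (auto simp: finite_fibres_def)
  ultimately show "gf (A \<times> B) (\<lambda>(x, y). u x + v y) $ n = (gf A u * gf B v) $ n"
    by (simp add: gf_nth fps_mult_nth card_cartesian_product)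
qed

lemma finite_fibres_Times:
  assumes "finite_fibres A u" "finite_fibres B v"
  shows "finite_fibres (A \<times> B) (\<lambda>(x, y). u x + v y)"
  unfolding finite_fibres_def
proof
  fix n
  have "{p \<in> A \<times> B. (case p of (x, y) \<Rightarrow> u x + v y) = n}
      \<subseteq> (\<Union>i\<in>{0..n}. {x \<in> A. u x = i} \<times> {y \<in> B. v y = n - i})"
    by force
  then show "finite {p \<in> A \<times> B. (case p of (x, y) \<Rightarrow> u x + v y) = n}"
    by (rule finite_subset) (use assms in \<open>auto simp: finite_fibres_def\<close>)
qed

lemma finite_fibres_image:
  assumes "finite_fibres A w" "\<And>x. x \<in> A \<Longrightarrow> w' (h x) = w x"
  shows "finite_fibres (h ` A) w'"
  unfolding finite_fibres_def
proof
  fix n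
  have "{y \<in> h ` A. w' y = n} \<subseteq> h ` {x \<in> A. w x = n}"
    using assms(2) by auto
  then show "finite {y \<in> h ` A. w' y = n}"
    by (rule finite_subset) (use assms(1) in \<open>auto simp: finite_fibres_def\<close>)
qed

section \<open>Partitions with bounded parts and the Durfee rectangle identity\<close>

definition Par :: "nat \<Rightarrow> nat \<Rightarrow> nat list set" where
  "Par c a = {xs. sorted_wrt (\<ge>) xs \<and> (\<forall>x\<in>set xs. c \<le> x \<and> x \<le> a)}"

text \<open>Subtracting \<open>lo\<close> from every part leaves a partition inside a
  \<open>d\<close> by \<open>hi - lo\<close> rectangle, hence the Gaussian binomial in
  \<open>gf_Box\<close>.\<close>

definition Box :: "nat \<Rightarrow> nat \<Rightarrow> nat \<Rightarrow> nat list set" where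
  "Box d lo hi = {xs \<in> Par lo hi. length xs = d}"

text \<open>For \<open>1 \<le> c\<close> this is the product of 1/(1 - q^i) over c \<le> i \<le> a,
  where q is \<open>fps_X\<close>.\<close>

abbreviation Par_gf :: "nat \<Rightarrow> nat \<Rightarrow> int fps" where
  "Par_gf c a \<equiv> gf (Par c a) sum_list"

lemma length_le_sum_list:
  fixes xs :: "nat list"
  shows "\<forall>x\<in>set xs. 1 \<le> x \<Longrightarrow> length xs \<le> sum_list xs"
  by (induction xs) auto

lemma finite_fibres_Par: "1 \<le> c \<Longrightarrow> finite_fibres (Par c a) sum_list"
  unfolding finite_fibres_def
proof
  fix n assume c: "1 \<le> c"
  have "{xs \<in> Par c a. sum_list xs = n} \<subseteq> {xs. set xs \<subseteq> {c..a} \<and> length xs \<le> n}"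
  proof
    fix xs assume "xs \<in> {xs \<in> Par c a. sum_list xs = n}"
    with c show "xs \<in> {xs. set xs \<subseteq> {c..a} \<and> length xs \<le> n}"
      using length_le_sum_list[of xs] by (fastforce simp: Par_def)
  qed
  then show "finite {xs \<in> Par c a. sum_list xs = n}"
    by (rule finite_subset) (rule finite_lists_length_le, simp)
qed

lemma finite_Box: "finite (Box d lo hi)"
proof -
  have "Box d lo hi \<subseteq> {xs. set xs \<subseteq> {lo..hi} \<and> length xs = d}" by (auto simp: Box_def Par_def)
  then show ?thesis by (rule finite_subset) (rule finite_lists_length_eq, simp)
qed

lemma finite_fibres_Box: "finite_fibres (Box d lo hi) w"
  by (simp add: finite_fibres_def finite_Box)

lemma Par_Suc:
  assumes "c \<le> Suc a"
  shows "Par c (Suc a) = Par c a \<union> Cons (Suc a) ` Par c (Suc a)"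
proof (intro equalityI subsetI)
  fix xs assume xs: "xs \<in> Par c (Suc a)"
  show "xs \<in> Par c a \<union> Cons (Suc a) ` Par c (Suc a)"
  proof (cases "\<exists>ys. xs = Suc a # ys")
    case True
    then show ?thesis using xs by (auto simp: Par_def)
  next
    case False
    then have "Suc a \<notin> set xs" using xs
      by (cases xs) (fastforce simp: Par_def)+
    then have "\<forall>x\<in>set xs. x \<le> a" using xs by (fastforce simp: Par_def le_Suc_eq)
    then show ?thesis using xs by (auto simp: Par_def)
  qed
qed (use assms in \<open>auto simp: Par_def\<close>)

lemma Par_gf_Suc:
  assumes "1 \<le> c" "c \<le> Suc a"
  shows "(1 - fps_X ^ Suc a) * Par_gf c (Suc a) = Par_gf c a"
proof -
  have 1: "gf (Cons (Suc a) ` Par c (Suc a)) sum_list = fps_X ^ Suc a * Par_gf c (Suc a)"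
    by (rule gf_image) auto
  have "Par_gf c (Suc a) = Par_gf c a + gf (Cons (Suc a) ` Par c (Suc a)) sum_list"
  proof -
    have "finite_fibres (Cons (Suc a) ` Par c (Suc a)) sum_list"
      by (rule finite_fibres_subset[OF finite_fibres_Par]) (use assms in \<open>auto simp: Par_def\<close>)
    moreover have "Par c a \<inter> Cons (Suc a) ` Par c (Suc a) = {}" by (auto simp: Par_def)
    ultimately have "gf (Par c a \<union> Cons (Suc a) ` Par c (Suc a)) sum_list
        = Par_gf c a + gf (Cons (Suc a) ` Par c (Suc a)) sum_list"
      by (rule gf_Un[OF finite_fibres_Par[OF assms(1)]])
    then show ?thesis by (subst Par_Suc[OF assms(2)])
  qed
  then show ?thesis unfolding 1 by (simp add: algebra_simps)
qed

lemma gf_Nil: "gf {[]} sum_list = 1"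
proof (rule fps_ext)
  fix n
  have "{x \<in> {[] :: nat list}. sum_list x = n} = (if n = 0 then {[]} else {})" by auto
  then show "gf {[]} sum_list $ n = 1 $ n" by (simp add: gf_nth)
qed

lemma Par_gf_empty: "a < c \<Longrightarrow> Par_gf c a = 1"
proof -
  assume "a < c"
  then have "xs = []" if "xs \<in> Par c a" for xs
    using that by (cases xs) (auto simp: Par_def)
  then have "Par c a = {[]}" by (auto simp: Par_def)
  then show ?thesis by (simp add: gf_Nil)
qed

lemma one_minus_X_power_nonzero: "(1 - fps_X ^ Suc n :: int fps) \<noteq> 0"
proof
  assume "(1 - fps_X ^ Suc n :: int fps) = 0"
  then have "(1 - fps_X ^ Suc n :: int fps) $ 0 = 0" by simp
  then show False by simp
qed

text \<open>Removing the smallest parts would mean editing the end of the list. Induction on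
  \<open>a\<close> avoids this: both sides obey the recurrence \<open>Par_gf_Suc\<close>, and its
  factor can be cancelled.\<close>

lemma Par_gf_Suc_left:
  assumes "1 \<le> c" "c \<le> a"
  shows "(1 - fps_X ^ c) * Par_gf c a = Par_gf (Suc c) a"
  using assms(2)
proof (induction a rule: dec_induct)
  case base
  obtain b where b: "c = Suc b" using assms(1) by (cases c) auto
  show ?case using Par_gf_Suc[of c b] b Par_gf_empty[of b c] Par_gf_empty[of c "Suc c"] by simp
next
  case (step a)
  have "(1 - fps_X ^ Suc a) * ((1 - fps_X ^ c) * Par_gf c (Suc a)) = (1 - fps_X ^ c) * Par_gf c a"
    using Par_gf_Suc[of c a] assms step by (simp add: mult.left_commute)
  also have "\<dots> = (1 - fps_X ^ Suc a) * Par_gf (Suc c) (Suc a)"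
    using Par_gf_Suc[of "Suc c" a] assms step by simp
  finally show ?case using one_minus_X_power_nonzero mult_cancel_left by blast
qed

section \<open>q-Pochhammer symbols and Gaussian binomial coefficients\<close>

definition qfac :: "nat \<Rightarrow> int fps" where
  "qfac n = (\<Prod>i\<in>{1..n}. 1 - fps_X ^ i)"

lemma qfac_0 [simp]: "qfac 0 = 1"
  by (simp add: qfac_def)

lemma qfac_Suc: "qfac (Suc n) = (1 - fps_X ^ Suc n) * qfac n"
  by (simp add: qfac_def prod.nat_ivl_Suc' mult.commute)

lemma qfac_nonzero: "qfac n \<noteq> 0"
  by (induction n) (use one_minus_X_power_nonzero in \<open>auto simp: qfac_Suc\<close>)

text \<open>The Gaussian binomial, given by a q-Pascal rule so that no division is required. Where
  \<open>A - i\<close> is truncated, the factor \<open>qbin A i\<close> is 0.\<close>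

fun qbin :: "nat \<Rightarrow> nat \<Rightarrow> int fps" where
  "qbin A 0 = 1"
| "qbin 0 (Suc i) = 0"
| "qbin (Suc A) (Suc i) = qbin A (Suc i) + fps_X ^ (A - i) * qbin A i"

lemma qbin_eq_0: "A < i \<Longrightarrow> qbin A i = 0"
  by (induction A i rule: qbin.induct) auto

text \<open>The product formula, with denominators cleared. The induction step combines the two
  q-Pascal terms by 1 - q^(d+w) = (1 - q^w) + q^w (1 - q^d).\<close>

lemma qbin_qfac: "qbin (d + w) d * qfac d * qfac w = qfac (d + w)"
proof (induction "d + w" arbitrary: d w)
  case 0
  then show ?case by simp
next
  case (Suc s)
  show ?case
  proof (cases d)
    case 0
    then show ?thesis by simp
  next
    case d: (Suc e)
    have s: "s = e + w" using Suc.hyps(2) d by simp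
    have 1: "qbin s e * qfac e * qfac w = qfac s"
      using Suc.hyps(1)[of e w] s by simp
    show ?thesis
    proof (cases w)
      case 0
      then have "qbin s (Suc e) = 0" using s by (simp add: qbin_eq_0)
      then have q: "qbin (d + w) d = qbin s e" using s d 0 by simp
      show ?thesis using 1 0 unfolding q by (auto simp: s d qfac_Suc)
    next
      case w: (Suc v)
      have 2: "qbin s (Suc e) * qfac (Suc e) * qfac v = qfac s"
        using Suc.hyps(1)[of "Suc e" v] s w by simp
      have q: "qbin (d + w) d = qbin s (Suc e) + fps_X ^ w * qbin s e"
        using s d by simp
      have "qbin (d + w) d * qfac d * qfac w
          = (1 - fps_X ^ w) * (qbin s (Suc e) * qfac (Suc e) * qfac v)
            + fps_X ^ w * (1 - fps_X ^ d) * (qbin s e * qfac e * qfac w)"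
        unfolding q by (simp only: d w qfac_Suc[of e] qfac_Suc[of v] distrib_left distrib_right mult_ac)
      also have "\<dots> = (1 - fps_X ^ (d + w)) * qfac s"
        unfolding 1 2 by (simp only: power_add ring_distribs mult_ac) simp
      finally show ?thesis using s d by (simp add: qfac_Suc)
    qed
  qed
qed

text \<open>The q-analogue of (i+1) C(A+1,i+1) = (A+1) C(A,i). It later trades a factor that depends
  on the summation index for a constant one.\<close>

lemma qbin_absorb:
  assumes "i \<le> A"
  shows "(1 - fps_X ^ Suc i) * qbin (Suc A) (Suc i) = (1 - fps_X ^ Suc A) * qbin A i"
proof -
  obtain w where A: "A = i + w" using assms le_Suc_ex by blast
  have "((1 - fps_X ^ Suc i) * qbin (Suc A) (Suc i)) * (qfac i * qfac w)
      = qbin (Suc i + w) (Suc i) * qfac (Suc i) * qfac w"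
    by (simp only: qfac_Suc A add_Suc mult_ac)
  also have "\<dots> = (1 - fps_X ^ Suc A) * (qbin A i * qfac i * qfac w)"
    unfolding qbin_qfac by (simp only: A qbin_qfac add_Suc qfac_Suc)
  finally have "((1 - fps_X ^ Suc i) * qbin (Suc A) (Suc i)) * (qfac i * qfac w)
      = ((1 - fps_X ^ Suc A) * qbin A i) * (qfac i * qfac w)" by (simp only: mult_ac)
  then show ?thesis using qfac_nonzero mult_cancel_right no_zero_divisors by metis
qed

text \<open>Combinatorially, a partition with parts at most \<open>A + c\<close> is cut at its
  largest rectangle with \<open>i\<close> rows and \<open>i + c\<close> columns:
  \<open>qbin A i\<close> counts what lies to the right, \<open>Par_gf 1 (i + c)\<close> what lies
  below. The proof is algebraic: the q-Pascal rule splits the sum for \<open>Suc A\<close> into the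
  sums for (A, c) and (A, c+1).\<close>

lemma durfee_rectangle_identity:
  "(\<Sum>i\<le>A. fps_X ^ (i * (i + c)) * qbin A i * Par_gf 1 (i + c)) = Par_gf 1 (A + c)"
proof (induction A arbitrary: c)
  case 0
  then show ?case by simp
next
  case (Suc A)
  have "(\<Sum>i\<le>Suc A. fps_X ^ (i * (i + c)) * qbin (Suc A) i * Par_gf 1 (i + c))
      = Par_gf 1 c + (\<Sum>i\<le>A. fps_X ^ (Suc i * (Suc i + c)) * qbin (Suc A) (Suc i) * Par_gf 1 (Suc i + c))"
    by (subst sum.atMost_Suc_shift) simp
  also have "(\<Sum>i\<le>A. fps_X ^ (Suc i * (Suc i + c)) * qbin (Suc A) (Suc i) * Par_gf 1 (Suc i + c))
      = (\<Sum>i\<le>A. fps_X ^ (Suc i * (Suc i + c)) * qbin A (Suc i) * Par_gf 1 (Suc i + c)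
              + fps_X ^ Suc (A + c) * (fps_X ^ (i * (i + Suc c)) * qbin A i * Par_gf 1 (i + Suc c)))"
  proof (rule sum.cong[OF refl])
    fix i assume "i \<in> {..A}"
    \<comment> \<open>The power from the q-Pascal rule completes the exponent to that of the
      identity for \<open>Suc c\<close>, up to a shift independent of \<open>i\<close>.\<close>
    then have i: "Suc i * (Suc i + c) + (A - i) = Suc (A + c) + i * (i + Suc c)"
      by (simp add: algebra_simps)
    have "fps_X ^ (Suc i * (Suc i + c)) * (fps_X ^ (A - i) * qbin A i) * Par_gf 1 (Suc i + c)
      = fps_X ^ (Suc i * (Suc i + c) + (A - i)) * qbin A i * Par_gf 1 (Suc i + c)"
      by (simp only: power_add mult_ac)
    also have "\<dots> = fps_X ^ Suc (A + c) * (fps_X ^ (i * (i + Suc c)) * qbin A i * Par_gf 1 (i + Suc c))"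
      by (subst i, subst power_add) (simp only: add_Suc_shift[of i c] mult_ac)
    finally show "fps_X ^ (Suc i * (Suc i + c)) * qbin (Suc A) (Suc i) * Par_gf 1 (Suc i + c)
       = fps_X ^ (Suc i * (Suc i + c)) * qbin A (Suc i) * Par_gf 1 (Suc i + c)
              + fps_X ^ Suc (A + c) * (fps_X ^ (i * (i + Suc c)) * qbin A i * Par_gf 1 (i + Suc c))"
      by (simp only: qbin.simps distrib_left distrib_right)
  qed
  also have "\<dots> = (\<Sum>i\<le>A. fps_X ^ (Suc i * (Suc i + c)) * qbin A (Suc i) * Par_gf 1 (Suc i + c))
      + fps_X ^ Suc (A + c) * Par_gf 1 (A + Suc c)"
    unfolding sum.distrib sum_distrib_left[symmetric] Suc.IH ..
  also have "Par_gf 1 c + ((\<Sum>i\<le>A. fps_X ^ (Suc i * (Suc i + c)) * qbin A (Suc i) * Par_gf 1 (Suc i + c))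
      + fps_X ^ Suc (A + c) * Par_gf 1 (A + Suc c))
     = (\<Sum>i\<le>Suc A. fps_X ^ (i * (i + c)) * qbin A i * Par_gf 1 (i + c))
      + fps_X ^ Suc (A + c) * Par_gf 1 (A + Suc c)"
    by (subst sum.atMost_Suc_shift) simp
  \<comment> \<open>The top term vanishes because \<open>qbin A (Suc A) = 0\<close>.\<close>
  also have "(\<Sum>i\<le>Suc A. fps_X ^ (i * (i + c)) * qbin A i * Par_gf 1 (i + c)) = Par_gf 1 (A + c)"
    using Suc.IH[of c] by (simp add: qbin_eq_0)
  also have "Par_gf 1 (A + c) + fps_X ^ Suc (A + c) * Par_gf 1 (A + Suc c) = Par_gf 1 (Suc A + c)"
    using Par_gf_Suc[of 1 "A + c"] by (simp add: algebra_simps)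
  finally show ?case .
qed

lemma Box_Suc:
  assumes "lo \<le> Suc hi"
  shows "Box (Suc d) lo (Suc hi) = Box (Suc d) lo hi \<union> Cons (Suc hi) ` Box d lo (Suc hi)"
proof -
  have "Box (Suc d) lo (Suc hi) = {xs \<in> Par lo hi. length xs = Suc d} \<union>
      {xs \<in> Cons (Suc hi) ` Par lo (Suc hi). length xs = Suc d}"
    unfolding Box_def by (subst Par_Suc[OF assms]) blast
  also have "\<dots> = Box (Suc d) lo hi \<union> Cons (Suc hi) ` Box d lo (Suc hi)"
    unfolding Box_def by auto
  finally show ?thesis .
qed

text \<open>Splitting by whether the first row has the maximal length \<open>lo + w\<close>
  reproduces the q-Pascal rule, the \<open>lo\<close> in that row supplying one more factor of
  q^lo.\<close>

lemma gf_Box: "gf (Box d lo (lo + w)) sum_list = fps_X ^ (d * lo) * qbin (d + w) d"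
proof (induction "d + w" arbitrary: d w)
  case 0
  then have "Box d lo (lo + w) = {[]}" by (auto simp: Box_def Par_def)
  then show ?case using 0 by (simp add: gf_Nil)
next
  case (Suc s)
  show ?case
  proof (cases d)
    case 0
    then have "Box d lo (lo + w) = {[]}" by (auto simp: Box_def Par_def)
    then show ?thesis using 0 by (simp add: gf_Nil)
  next
    case d: (Suc e)
    have s: "s = e + w" using Suc.hyps(2) d by simp
    have 1: "gf (Box e lo (lo + w)) sum_list = fps_X ^ (e * lo) * qbin s e"
      using Suc.hyps(1)[of e w] s by simp
    show ?thesis
    proof (cases w)
      case 0
      have "Box d lo (lo + w) = Cons lo ` Box e lo (lo + w)"
        unfolding d 0 by (auto simp: Box_def Par_def length_Suc_conv image_iff)
      moreover have "gf (Cons lo ` Box e lo (lo + w)) sum_list = fps_X ^ lo * gf (Box e lo (lo + w)) sum_list"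
        by (rule gf_image) auto
      moreover have "qbin (d + w) d = qbin s e" using s d 0 by (simp add: qbin_eq_0)
      ultimately show ?thesis using 1 d by (simp add: power_add mult.assoc)
    next
      case w: (Suc v)
      have 2: "gf (Box d lo (lo + v)) sum_list = fps_X ^ (d * lo) * qbin s d"
        using Suc.hyps(1)[of d v] s d w by simp
      have "Box d lo (lo + w) = Box d lo (lo + v) \<union> Cons (lo + w) ` Box e lo (lo + w)"
        unfolding d w using Box_Suc[of lo "lo + v" e] by simp
      moreover have "gf (Box d lo (lo + v) \<union> Cons (lo + w) ` Box e lo (lo + w)) sum_list
        = gf (Box d lo (lo + v)) sum_list + gf (Cons (lo + w) ` Box e lo (lo + w)) sum_list"
        by (rule gf_Un) (auto simp: finite_fibres_def finite_Box, auto simp: Box_def Par_def w)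
      moreover have "gf (Cons (lo + w) ` Box e lo (lo + w)) sum_list
          = fps_X ^ (lo + w) * gf (Box e lo (lo + w)) sum_list"
        by (rule gf_image) auto
      ultimately have "gf (Box d lo (lo + w)) sum_list
         = fps_X ^ (d * lo) * qbin s d + fps_X ^ (lo + w) * (fps_X ^ (e * lo) * qbin s e)"
        using 1 2 by simp
      also have "\<dots> = fps_X ^ (d * lo) * qbin (d + w) d"
        using s d w by (simp add: power_add algebra_simps)
      finally show ?thesis .
    qed
  qed
qed

section \<open>Successive Durfee squares\<close>

lemma square_subset_ferrers_iff:
  "{..<d} \<times> {..<d} \<subseteq> ferrers xs \<longleftrightarrow> d \<le> length xs \<and> (\<forall>i<d. d \<le> xs ! i)"
proof
  assume L: "{..<d} \<times> {..<d} \<subseteq> ferrers xs"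
  have "i < length xs \<and> d \<le> xs ! i" if "i < d" for i
  proof -
    have "(i, d - 1) \<in> ferrers xs" using L that by auto
    then show ?thesis using that by (auto simp: ferrers_def)
  qed
  then show "d \<le> length xs \<and> (\<forall>i<d. d \<le> xs ! i)"
    by (meson not_le less_irrefl)
qed (force simp: ferrers_def)

text \<open>A larger square would force the first part of \<open>r\<close> above
  \<open>length t\<close>.\<close>

lemma durfee_append:
  assumes "\<forall>x\<in>set t. length t \<le> x" "\<forall>x\<in>set r. x \<le> length t"
  shows "durfee (t @ r) = length t"
  unfolding durfee_def square_subset_ferrers_iff
proof (rule Max_eqI)
  show "finite {d. d \<le> length (t @ r) \<and> (\<forall>i<d. d \<le> (t @ r) ! i)}"
    by (rule finite_subset[of _ "{..length (t @ r)}"]) auto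
  show "length t \<in> {d. d \<le> length (t @ r) \<and> (\<forall>i<d. d \<le> (t @ r) ! i)}"
    using assms(1) by (auto simp: nth_append)
  fix d assume d: "d \<in> {d. d \<le> length (t @ r) \<and> (\<forall>i<d. d \<le> (t @ r) ! i)}"
  show "d \<le> length t"
  proof (rule ccontr)
    assume "\<not> d \<le> length t"
    then have "length t < d" "r \<noteq> []" using d by auto
    then have "d \<le> (t @ r) ! length t" "r ! 0 \<in> set r" using d by auto
    then have "d \<le> r ! 0" "r ! 0 \<in> set r" by (auto simp: nth_append)
    then show False using assms(2) \<open>\<not> d \<le> length t\<close> by fastforce
  qed
qed

text \<open>If a row below the square were longer than its side, all rows above would be too, by
  sortedness, and the square could be enlarged.\<close>

lemma durfee_take_drop:
  assumes "sorted_wrt (\<ge>) xs"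
  shows "durfee xs \<le> length xs" "\<forall>x\<in>set (take (durfee xs) xs). durfee xs \<le> x"
    "\<forall>x\<in>set (drop (durfee xs) xs). x \<le> durfee xs"
proof -
  let ?S = "{d. d \<le> length xs \<and> (\<forall>i<d. d \<le> xs ! i)}"
  have dS: "durfee xs = Max ?S" unfolding durfee_def square_subset_ferrers_iff ..
  have fin: "finite ?S" by (rule finite_subset[of _ "{..length xs}"]) auto
  have mem: "durfee xs \<in> ?S" unfolding dS by (rule Max_in[OF fin]) auto
  then show "durfee xs \<le> length xs" "\<forall>x\<in>set (take (durfee xs) xs). durfee xs \<le> x"
    by (auto simp: in_set_conv_nth)
  show "\<forall>x\<in>set (drop (durfee xs) xs). x \<le> durfee xs"
  proof (rule ccontr)
    assume "\<not> (\<forall>x\<in>set (drop (durfee xs) xs). x \<le> durfee xs)"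
    then obtain i where i: "i < length xs - durfee xs" "durfee xs < xs ! (durfee xs + i)"
      by (auto simp: in_set_conv_nth not_le)
    have "Suc (durfee xs) \<in> ?S"
    proof (intro CollectI conjI allI impI)
      show "Suc (durfee xs) \<le> length xs" using i by simp
      fix i' assume "i' < Suc (durfee xs)"
      then have "xs ! (durfee xs + i) \<le> xs ! i'"
        using assms i by (cases "i' = durfee xs + i") (auto simp: sorted_wrt_iff_nth_less)
      then show "Suc (durfee xs) \<le> xs ! i'" using i by simp
    qed
    then have "Suc (durfee xs) \<le> durfee xs" unfolding dS by (rule Max_ge[OF fin])
    then show False by simp
  qed
qed

text \<open>The bound \<open>a\<close> makes the recursion possible: below a Durfee square of side
  \<open>d\<close> all parts are at most \<open>d\<close>.\<close>

definition squares :: "nat \<Rightarrow> nat \<Rightarrow> nat list set" where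
  "squares j a = {xs \<in> Par 1 a. has_durfee_squares j xs}"

definition excess :: "nat \<Rightarrow> nat list \<Rightarrow> nat" where
  "excess j xs = length (below_durfee j xs)"

text \<open>For \<open>j = 0\<close> the bound \<open>a\<close> on the parts plays the role of the last Durfee square.\<close>

definition last_side :: "nat \<Rightarrow> nat \<Rightarrow> nat list \<Rightarrow> nat" where
  "last_side j a xs = (if j = 0 then a else durfee_side j xs)"

lemma below_durfee_Suc: "below_durfee (Suc j) xs = below_durfee j (drop (durfee xs) xs)"
  by (simp add: below_durfee_def funpow_Suc_right del: funpow.simps)

lemma below_durfee_0: "below_durfee 0 xs = xs"
  by (simp add: below_durfee_def)

lemma has_durfee_squares_Suc:
  "has_durfee_squares (Suc j) xs \<longleftrightarrow>
     0 < durfee xs \<and> has_durfee_squares j (drop (durfee xs) xs)"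
proof -
  have 1: "{1..Suc j} = insert 1 (Suc ` {1..j})" by (force simp: image_Suc_atLeastAtMost)
  have 2: "durfee_side (Suc i) xs = durfee_side i (drop (durfee xs) xs)" if "i \<in> {1..j}" for i
    using that by (cases i) (auto simp: durfee_side_def below_durfee_Suc)
  have 3: "durfee_side 1 xs = durfee xs" by (simp add: durfee_side_def below_durfee_0)
  show ?thesis
    unfolding has_durfee_squares_def 1 ball_simps 3 using 2 by (intro conj_cong ball_cong) auto
qed

text \<open>The rows of \<open>t\<close> are exactly those of the first square, so the remaining
  Durfee data are read off \<open>r\<close>. For \<open>j = 0\<close> the third equation rests on
  the convention for \<open>last_side\<close>.\<close>

lemma Box_append_facts:
  assumes "t \<in> Box d d a" "r \<in> Par 1 d"
  shows "durfee (t @ r) = d" "excess (Suc j) (t @ r) = excess j r"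
    "last_side (Suc j) a (t @ r) = last_side j d r"
    "1 \<le> d \<Longrightarrow> has_durfee_squares (Suc j) (t @ r) \<longleftrightarrow> has_durfee_squares j r"
proof -
  show 1: "durfee (t @ r) = d"
    using assms durfee_append[of t r] by (auto simp: Box_def Par_def)
  have 2: "drop (durfee (t @ r)) (t @ r) = r" using 1 assms by (auto simp: Box_def)
  then show "excess (Suc j) (t @ r) = excess j r"
    by (simp add: excess_def below_durfee_Suc)
  show "last_side (Suc j) a (t @ r) = last_side j d r"
    using 1 2 by (cases j) (auto simp: last_side_def durfee_side_def below_durfee_Suc below_durfee_0)
  show "1 \<le> d \<Longrightarrow> has_durfee_squares (Suc j) (t @ r) \<longleftrightarrow> has_durfee_squares j r"
    using 1 2 by (simp add: has_durfee_squares_Suc)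
qed

lemma Box_length_le: "t \<in> Box d d a \<Longrightarrow> 1 \<le> d \<Longrightarrow> d \<le> a"
  by (cases t) (auto simp: Box_def Par_def)

text \<open>Cut each partition directly below its first Durfee square, of side
  \<open>d\<close>.\<close>

lemma squares_Suc:
  "squares (Suc j) a = (\<Union>d\<in>{1..a}. (\<lambda>(t, r). t @ r) ` (Box d d a \<times> squares j d))"
proof (intro equalityI subsetI)
  fix xs assume xs: "xs \<in> squares (Suc j) a"
  define d where "d = durfee xs"
  have so: "sorted_wrt (\<ge>) xs" using xs by (simp add: squares_def Par_def)
  note td = durfee_take_drop[OF so, folded d_def]
  have bd: "\<forall>x\<in>set xs. 1 \<le> x \<and> x \<le> a" using xs by (simp add: squares_def Par_def)
  have d: "1 \<le> d" "has_durfee_squares j (drop d xs)"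
    using xs unfolding squares_def d_def by (auto simp: has_durfee_squares_Suc)
  have t: "take d xs \<in> Box d d a"
    using td(1,2) bd sorted_wrt_take[OF so, of d] by (auto simp: Box_def Par_def dest: in_set_takeD)
  have r: "drop d xs \<in> squares j d"
    using td(3) bd d(2) sorted_wrt_drop[OF so, of d]
    by (auto simp: Par_def squares_def dest: in_set_dropD)
  have "xs = (\<lambda>(t, r). t @ r) (take d xs, drop d xs)" by simp
  moreover have "d \<in> {1..a}" using Box_length_le[OF t] d by simp
  ultimately show "xs \<in> (\<Union>d\<in>{1..a}. (\<lambda>(t, r). t @ r) ` (Box d d a \<times> squares j d))"
    using t r by blast
next
  fix xs assume "xs \<in> (\<Union>d\<in>{1..a}. (\<lambda>(t, r). t @ r) ` (Box d d a \<times> squares j d))"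
  then obtain d t r where *: "d \<in> {1..a}" "t \<in> Box d d a" "r \<in> squares j d" "xs = t @ r"
    by (elim UN_E imageE SigmaE) auto
  have "has_durfee_squares (Suc j) xs"
    using * Box_append_facts(4)[of t d a r j] by (simp add: squares_def)
  moreover have "xs \<in> Par 1 a"
  proof -
    have "d \<le> a" "1 \<le> d" using *(1) by auto
    then show ?thesis
      using *(2-4) by (auto simp: Par_def Box_def squares_def sorted_wrt_append intro: order_trans)
  qed
  ultimately show "xs \<in> squares (Suc j) a" by (simp add: squares_def)
qed

lemma last_side_bounds:
  "1 \<le> a \<Longrightarrow> xs \<in> squares j a \<Longrightarrow> 1 \<le> last_side j a xs \<and> last_side j a xs \<le> a"
proof (induction j arbitrary: a xs)
  case 0
  then show ?case by (simp add: last_side_def)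
next
  case (Suc j)
  from Suc.prems(2) obtain d t r where
    *: "d \<in> {1..a}" "t \<in> Box d d a" "r \<in> squares j d" "xs = t @ r"
    unfolding squares_Suc by (elim UN_E imageE SigmaE) auto
  then have "last_side (Suc j) a xs = last_side j d r"
    using Box_append_facts(3) by (simp add: squares_def)
  then show ?case using Suc.IH[of d r] * by auto
qed

text \<open>The sum of q^(|\<mu>|+b) (1 - q^N), with \<open>b\<close> the excess and
  \<open>N\<close> the last side of \<mu>, written as a difference of two counting series.\<close>

definition squares_gf :: "nat \<Rightarrow> nat \<Rightarrow> int fps" where
  "squares_gf j a = gf (squares j a) (\<lambda>xs. sum_list xs + excess j xs)
         - gf (squares j a) (\<lambda>xs. sum_list xs + excess j xs + last_side j a xs)"

lemma finite_fibres_squares: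
  "(\<And>xs. sum_list xs \<le> w xs) \<Longrightarrow> finite_fibres (squares j a) w"
  by (rule finite_fibres_mono[of _ sum_list])
    (auto intro!: finite_fibres_subset[OF finite_fibres_Par[of 1 a]] simp: squares_def)

text \<open>Stated for every weight that splits along the cut, so as to cover both terms of
  \<open>squares_gf\<close>. The union is disjoint since \<open>d\<close> is recovered as
  \<open>durfee xs\<close>.\<close>

lemma gf_squares_Suc:
  assumes w: "\<And>d t r. t \<in> Box d d a \<Longrightarrow> r \<in> squares j d \<Longrightarrow> w (t @ r) = sum_list t + v d r"
    and v: "\<And>d r. sum_list r \<le> v d r"
  shows "gf (squares (Suc j) a) w
    = (\<Sum>d\<in>{1..a}. gf (Box d d a) sum_list * gf (squares j d) (v d))"
proof -
  let ?ap = "\<lambda>(t, r). t @ r :: nat list"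
  have fin: "finite_fibres (squares j d) (v d)" for d
    using v by (rule finite_fibres_squares)
  have w': "w (?ap x) = (case x of (t, r) \<Rightarrow> sum_list t + v d r)"
    if "x \<in> Box d d a \<times> squares j d" for x d
    using that w by auto
  have inj: "inj_on ?ap (Box d d a \<times> squares j d)" for d
    by (auto simp: inj_on_def Box_def)
  have one: "gf (?ap ` (Box d d a \<times> squares j d)) w
      = gf (Box d d a) sum_list * gf (squares j d) (v d)" for d
  proof -
    have "gf (?ap ` (Box d d a \<times> squares j d)) w
      = fps_X ^ 0 * gf (Box d d a \<times> squares j d) (\<lambda>(t, r). sum_list t + v d r)"
      using w' by (intro gf_image[OF inj]) auto
    then show ?thesis by (simp add: gf_Times[OF finite_fibres_Box fin])
  qed
  have "gf (squares (Suc j) a) w = (\<Sum>d\<in>{1..a}. gf (?ap ` (Box d d a \<times> squares j d)) w)"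
    unfolding squares_Suc
  proof (rule gf_UN)
    fix d
    show "finite_fibres (?ap ` (Box d d a \<times> squares j d)) w"
      by (rule finite_fibres_image[OF finite_fibres_Times[OF finite_fibres_Box[of d d a sum_list] fin[of d]]])
        (use w' in auto)
  next
    fix d d' xs
    assume "xs \<in> ?ap ` (Box d d a \<times> squares j d)" "xs \<in> ?ap ` (Box d' d' a \<times> squares j d')"
    then have "durfee xs = d" "durfee xs = d'"
      using Box_append_facts(1) by (auto simp: squares_def)
    then show "d = d'" by simp
  qed simp
  then show ?thesis by (simp add: one)
qed

lemma squares_gf_Suc: "squares_gf (Suc j) a = (\<Sum>d\<in>{1..a}. gf (Box d d a) sum_list * squares_gf j d)"
proof -
  have 1: "gf (squares (Suc j) a) (\<lambda>xs. sum_list xs + excess (Suc j) xs)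
    = (\<Sum>d\<in>{1..a}. gf (Box d d a) sum_list * gf (squares j d) (\<lambda>xs. sum_list xs + excess j xs))"
    by (rule gf_squares_Suc) (auto simp: Box_append_facts(2) squares_def)
  have 2: "gf (squares (Suc j) a) (\<lambda>xs. sum_list xs + excess (Suc j) xs + last_side (Suc j) a xs)
    = (\<Sum>d\<in>{1..a}. gf (Box d d a) sum_list *
          gf (squares j d) (\<lambda>xs. sum_list xs + excess j xs + last_side j d xs))"
    by (rule gf_squares_Suc) (auto simp: Box_append_facts(2,3) squares_def)
  show ?thesis unfolding squares_gf_def 1 2 by (simp add: right_diff_distrib sum_subtractf)
qed

text \<open>Adding 1 to each part absorbs the length into the sum of the parts.\<close>

lemma gf_Par_length: "gf (Par 1 a) (\<lambda>xs. sum_list xs + length xs) = Par_gf 2 (Suc a)"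
proof -
  have "Par 2 (Suc a) = map Suc ` Par 1 a"
  proof (intro equalityI subsetI)
    fix xs assume xs: "xs \<in> Par 2 (Suc a)"
    have "xs = map Suc (map (\<lambda>x. x - 1) xs)"
      unfolding map_map by (rule map_idI[symmetric]) (use xs in \<open>auto simp: Par_def\<close>)
    moreover have "map (\<lambda>x. x - 1) xs \<in> Par 1 a"
    proof -
      have "sorted_wrt (\<lambda>x y. y - 1 \<le> x - 1) xs"
        by (rule sorted_wrt_mono_rel[of _ "(\<ge>)"]) (use xs in \<open>auto simp: Par_def\<close>)
      then show ?thesis using xs by (auto simp: Par_def sorted_wrt_map)
    qed
    ultimately show "xs \<in> map Suc ` Par 1 a" by blast
  qed (auto simp: Par_def sorted_wrt_map)
  moreover have "gf (map Suc ` Par 1 a) sum_list = fps_X ^ 0 * gf (Par 1 a) (\<lambda>xs. sum_list xs + length xs)"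
    by (rule gf_image) (auto simp: inj_on_def inj_map_eq_map sum_list_Suc)
  ultimately show ?thesis by simp
qed

lemma squares_gf_0: "squares_gf 0 a = (1 - fps_X ^ a) * (1 - fps_X) * Par_gf 1 (Suc a)"
proof -
  have sq: "squares 0 a = Par 1 a" by (simp add: squares_def has_durfee_squares_def)
  have ex: "excess 0 xs = length xs" for xs by (simp add: excess_def below_durfee_0)
  \<comment> \<open>With the identity as the map, \<open>gf_image\<close> just shifts the weight by
    the constant \<open>a\<close>.\<close>
  have "gf (id ` Par 1 a) (\<lambda>xs. sum_list xs + length xs + a)
      = fps_X ^ a * gf (Par 1 a) (\<lambda>xs. sum_list xs + length xs)"
    by (rule gf_image) auto
  then have "squares_gf 0 a = (1 - fps_X ^ a) * Par_gf 2 (Suc a)"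
    unfolding squares_gf_def sq ex last_side_def image_id gf_Par_length
    by (simp only: id_apply gf_Par_length left_diff_distrib mult_1_left if_True simp_thms)
  also have "Par_gf 2 (Suc a) = (1 - fps_X) * Par_gf 1 (Suc a)"
    using Par_gf_Suc_left[of 1 "Suc a"] by (simp add: numeral_2_eq_2)
  finally show ?thesis by (simp add: mult.assoc)
qed

text \<open>The reason why one more square costs one factor q. Put d = i + 1: absorption turns the
  factor 1 - q^d into the constant 1 - q^a, and d^2 = i(i+2) + 1 leaves q times the Durfee rectangle
  identity with \<open>c = 2\<close>.\<close>

lemma sum_Box_squares_gf_0: "(\<Sum>d\<in>{1..a}. gf (Box d d a) sum_list * squares_gf 0 d) = fps_X * squares_gf 0 a"
proof (cases a)
  case 0
  then show ?thesis by (simp add: squares_gf_0)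
next
  case (Suc A)
  have "(\<Sum>d\<in>{1..a}. gf (Box d d a) sum_list * squares_gf 0 d)
      = (\<Sum>i\<le>A. gf (Box (Suc i) (Suc i) a) sum_list * squares_gf 0 (Suc i))"
    unfolding Suc One_nat_def by (subst sum.atLeast_Suc_atMost_Suc_shift) (simp add: atMost_atLeast0)
  also have "\<dots> = (\<Sum>i\<le>A. fps_X * (1 - fps_X ^ a) * (1 - fps_X) *
      (fps_X ^ (i * (i + 2)) * qbin A i * Par_gf 1 (i + 2)))"
  proof (rule sum.cong[OF refl])
    fix i assume "i \<in> {..A}"
    then have i: "i \<le> A" by simp
    have "gf (Box (Suc i) (Suc i) a) sum_list = fps_X ^ (Suc i * Suc i) * qbin (Suc A) (Suc i)"
      using gf_Box[of "Suc i" "Suc i" "A - i"] i Suc by simp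
    then have "gf (Box (Suc i) (Suc i) a) sum_list * squares_gf 0 (Suc i)
        = fps_X ^ (Suc i * Suc i) * (((1 - fps_X ^ Suc i) * qbin (Suc A) (Suc i)) *
            ((1 - fps_X) * Par_gf 1 (i + 2)))"
      unfolding squares_gf_0 by (simp only: mult_ac numeral_2_eq_2 add_Suc_right add_0_right)
    also have "\<dots> = fps_X ^ (Suc i * Suc i) * (((1 - fps_X ^ a) * qbin A i) *
            ((1 - fps_X) * Par_gf 1 (i + 2)))"
      unfolding qbin_absorb[OF i] Suc ..
    also have "Suc i * Suc i = Suc (i * (i + 2))" by simp
    finally show "gf (Box (Suc i) (Suc i) a) sum_list * squares_gf 0 (Suc i)
        = fps_X * (1 - fps_X ^ a) * (1 - fps_X) * (fps_X ^ (i * (i + 2)) * qbin A i * Par_gf 1 (i + 2))"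
      by (simp only: power_Suc mult_ac)
  qed
  also have "\<dots> = fps_X * (1 - fps_X ^ a) * (1 - fps_X) * Par_gf 1 (A + 2)"
    unfolding sum_distrib_left[symmetric] durfee_rectangle_identity ..
  also have "\<dots> = fps_X * squares_gf 0 a"
    unfolding squares_gf_0 Suc by (simp add: mult_ac)
  finally show ?thesis .
qed

lemma squares_gf_eq_power_mult: "squares_gf j a = fps_X ^ j * squares_gf 0 a"
proof (induction j arbitrary: a)
  case (Suc j)
  have "squares_gf (Suc j) a = (\<Sum>d\<in>{1..a}. fps_X ^ j * (gf (Box d d a) sum_list * squares_gf 0 d))"
    unfolding squares_gf_Suc by (subst Suc.IH) (simp only: mult.left_commute)
  also have "\<dots> = fps_X ^ Suc j * squares_gf 0 a"
    unfolding sum_distrib_left[symmetric] sum_Box_squares_gf_0 by (simp add: mult_ac)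
  finally show ?case .
qed simp

section \<open>The \<open>k\<close>-rank in the range \<open>n < 2 m\<close>\<close>

lemma Box_iff:
  "xs \<in> Box d lo hi \<longleftrightarrow> sorted_wrt (\<ge>) xs \<and> (\<forall>x\<in>set xs. lo \<le> x \<and> x \<le> hi) \<and> length xs = d"
  by (auto simp: Box_def Par_def)

lemma Box_snoc: "xs @ [g] \<in> Box (Suc d) g a \<longleftrightarrow> xs \<in> Box d g a \<and> g \<le> a"
  by (auto simp: Box_iff sorted_wrt_append)

lemma Box_Cons: "x # xs \<in> Box (Suc d) g a \<longleftrightarrow> xs \<in> Box d g a \<and> g \<le> x \<and> x \<le> a \<and> (\<forall>y\<in>set xs. y \<le> x)"
  by (auto simp: Box_iff)

lemma Box_map_Suc_pred:
  assumes "xs \<in> Box d (Suc g) (Suc a)"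
  obtains ys where "ys \<in> Box d g a" "xs = map Suc ys"
proof
  have "sorted_wrt (\<lambda>x y. y - 1 \<le> x - 1) xs"
    by (rule sorted_wrt_mono_rel[of _ "(\<ge>)"]) (use assms in \<open>auto simp: Box_iff\<close>)
  then show "map (\<lambda>x. x - 1) xs \<in> Box d g a"
    using assms by (fastforce simp: Box_iff sorted_wrt_map)
  show "xs = map Suc (map (\<lambda>x. x - 1) xs)"
    unfolding map_map by (rule map_idI[symmetric]) (use assms in \<open>auto simp: Box_iff\<close>)
qed

lemma member_le_sum_list_nat: "x \<in> set xs \<Longrightarrow> x \<le> sum_list (xs :: nat list)"
  by (induction xs) auto

text \<open>A sequence of first rows whose largest row is \<open>M + g\<close> is turned into one that is shorter by
  \<open>M\<close> and ends in \<open>g\<close>, by moving the shortened largest row to the end; all other sequences have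
  every row longer than \<open>g\<close>.\<close>

lemma card_top_rows:
  assumes "1 \<le> N" "s \<le> a" "s < 2 * M"
  shows "card {h \<in> Box N g a. sum_list h = s \<and> hd h = M + g}
       + card {h \<in> Box N g a. sum_list h + N + M = s}
       = card {h \<in> Box N g a. sum_list h + M = s}"
proof -
  obtain N' where N: "N = Suc N'" using assms(1) by (cases N) auto
  \<comment> \<open>\<open>?C\<close> holds the other \<open>N'\<close> rows: prefixing
    \<open>M + g\<close> gives the first set of the claim, appending \<open>g\<close> gives
    \<open>?Y1\<close>.\<close>
  let ?C = "{h \<in> Box N' g a. sum_list h + g + M = s}"
  let ?Y = "{h \<in> Box N g a. sum_list h + M = s}"
  let ?Y1 = "{h \<in> ?Y. last h = g}" and ?Y2 = "{h \<in> ?Y. last h \<noteq> g}"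
  let ?Z = "{h \<in> Box N g a. sum_list h + N + M = s}"
  have "{h \<in> Box N g a. sum_list h = s \<and> hd h = M + g} = Cons (M + g) ` ?C" (is "?X = _")
  proof (intro equalityI subsetI)
    fix h assume "h \<in> ?X"
    moreover then obtain x xs where "h = x # xs" by (cases h) (auto simp: N Box_iff)
    ultimately show "h \<in> Cons (M + g) ` ?C" by (auto simp: N Box_Cons)
  next
    fix h assume "h \<in> Cons (M + g) ` ?C"
    then obtain xs where xs: "h = (M + g) # xs" "xs \<in> ?C" by blast
    \<comment> \<open>The other rows sum to \<open>s - g - M\<close>, which is less than
      \<open>M\<close> because \<open>s < 2 * M\<close>; so \<open>M + g\<close> is the largest
      row.\<close>
    have "y \<le> M + g" if "y \<in> set xs" for y
      using member_le_sum_list_nat[OF that] xs assms by auto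
    then show "h \<in> ?X" using xs assms by (auto simp: N Box_Cons)
  qed
  then have X: "card ?X = card ?C" by (simp add: card_image)
  have "?Y1 = (\<lambda>xs. xs @ [g]) ` ?C"
  proof (intro equalityI subsetI)
    fix h assume h: "h \<in> ?Y1"
    then have "h \<noteq> []" by (auto simp: N Box_iff)
    then have "h = butlast h @ [g]"
      using h by (metis (mono_tags, lifting) append_butlast_last_id mem_Collect_eq)
    then obtain xs where "h = xs @ [g]" by blast
    then show "h \<in> (\<lambda>xs. xs @ [g]) ` ?C" using h by (auto simp: N Box_snoc)
  next
    fix h assume "h \<in> (\<lambda>xs. xs @ [g]) ` ?C"
    then obtain xs where xs: "h = xs @ [g]" "xs \<in> ?C" by blast
    then show "h \<in> ?Y1" using assms by (auto simp: N Box_snoc)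
  qed
  then have Y1: "card ?Y1 = card ?C" by (simp add: card_image inj_on_def)
  \<comment> \<open>If the last row exceeds \<open>g\<close>, all rows do, and each of the
    \<open>N\<close> rows can lose one cell. This accounts for the factor 1 - q^N.\<close>
  have "?Y2 = map Suc ` ?Z"
  proof (intro equalityI subsetI)
    fix h assume h: "h \<in> ?Y2"
    then have ne: "h \<noteq> []" by (auto simp: N Box_iff)
    then have hs: "h = butlast h @ [last h]" by simp
    have so: "sorted_wrt (\<ge>) h" using h by (simp add: Box_iff)
    have "last h \<le> x" if "x \<in> set h" for x
    proof -
      have "sorted_wrt (\<ge>) (butlast h @ [last h])" using so hs by simp
      moreover have "x \<in> set (butlast h) \<or> x = last h"
        using that hs by (metis Un_iff empty_iff empty_set insert_iff set_append list.set(2))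
      ultimately show ?thesis unfolding sorted_wrt_append by auto
    qed
    moreover have "g < last h" using h last_in_set[OF ne] by (force simp: Box_iff)
    ultimately have "h \<in> Box N (Suc g) (Suc a)" using h by (fastforce simp: Box_iff)
    then obtain ys where ys: "ys \<in> Box N g a" "h = map Suc ys" by (rule Box_map_Suc_pred)
    moreover have "ys \<in> ?Z" using ys h by (auto simp: sum_list_Suc Box_iff)
    ultimately show "h \<in> map Suc ` ?Z" by blast
  next
    fix h assume "h \<in> map Suc ` ?Z"
    then obtain ys where ys: "h = map Suc ys" "ys \<in> ?Z" by blast
    have s: "sum_list h + M = s" using ys by (auto simp: sum_list_Suc Box_iff)
    have "x \<le> a" if "x \<in> set h" for x
      using member_le_sum_list_nat[OF that] s assms by auto
    moreover have ne: "ys \<noteq> []" using ys by (auto simp: N Box_iff)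
    moreover have "g \<le> last ys" using ys last_in_set[OF ne] by (auto simp: Box_iff)
    then have "last h \<noteq> g" using ys ne by (simp add: last_map)
    ultimately show "h \<in> ?Y2" using ys s by (auto simp: Box_iff sorted_wrt_map)
  qed
  then have Y2: "card ?Y2 = card ?Z" by (simp add: card_image inj_on_def inj_map_eq_map)
  have "card ?Y = card (?Y1 \<union> ?Y2)" by (rule arg_cong[of _ _ card]) auto
  also have "\<dots> = card ?Y1 + card ?Y2"
    by (rule card_Un_disjoint) (auto intro: finite_subset[OF _ finite_Box[of N g a]])
  finally show ?thesis using X Y1 Y2 by simp
qed

text \<open>Counting through a unique decomposition, used both for cutting below the top
  \<open>N\<close> rows and for cutting below the first square.\<close>

lemma card_Sigma_decomposition:
  assumes "finite I" "\<And>w. w \<in> I \<Longrightarrow> finite (A w)"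
    "\<And>w h. w \<in> I \<Longrightarrow> h \<in> A w \<Longrightarrow> f w h \<in> X"
    "\<And>x. x \<in> X \<Longrightarrow> \<exists>w\<in>I. \<exists>h\<in>A w. x = f w h"
    "\<And>w h w' h'. w \<in> I \<Longrightarrow> h \<in> A w \<Longrightarrow> w' \<in> I \<Longrightarrow> h' \<in> A w' \<Longrightarrow> f w h = f w' h' \<Longrightarrow> w = w' \<and> h = h'"
  shows "card X = (\<Sum>w\<in>I. card (A w))"
proof -
  have "bij_betw (\<lambda>(w, h). f w h) (SIGMA w:I. A w) X"
    unfolding bij_betw_def
  proof (intro conjI equalityI subsetI)
    show "inj_on (\<lambda>(w, h). f w h) (SIGMA w:I. A w)"
      using assms(5) by (fastforce simp: inj_on_def)
    fix x assume "x \<in> X"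
    from assms(4)[OF this] show "x \<in> (\<lambda>(w, h). f w h) ` (SIGMA w:I. A w)" by auto
  qed (use assms(3) in auto)
  then have "card X = card (SIGMA w:I. A w)" using bij_betw_same_card by metis
  also have "\<dots> = (\<Sum>w\<in>I. card (A w))"
    using assms(1,2) by (simp add: card_SigmaI)
  finally show ?thesis .
qed

text \<open>Here \<open>w\<close> lists the rows of the first square below the top \<open>N\<close>.
  The value is the index of the first column that counts for the \<open>k\<close>-rank; with no such
  rows this is \<open>d\<close>, the right edge of the square.\<close>

definition next_row :: "nat \<Rightarrow> nat list \<Rightarrow> nat" where
  "next_row d w = (if w = [] then d else hd w)"

lemma Box_append:
  assumes "d \<le> a" "w \<in> Box e d a"
  shows "h @ w \<in> Box (N + e) d a \<longleftrightarrow> h \<in> Box N (next_row d w) a"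
proof (cases w)
  case Nil
  then show ?thesis using assms by (auto simp: Box_iff next_row_def)
next
  case (Cons y ys)
  have "y \<in> set w" using Cons by simp
  then show ?thesis using assms Cons
    by (auto simp: Box_iff next_row_def sorted_wrt_append intro: order_trans)
qed

text \<open>Once the rows \<open>w\<close> are fixed, the top \<open>N\<close> rows range over a
  box, where \<open>card_top_rows\<close> applies.\<close>

lemma card_Box_split:
  assumes "N \<le> d" "d \<le> a"
  shows "card {t \<in> Box d d a. Q t}
    = (\<Sum>w\<in>Box (d - N) d a. card {h \<in> Box N (next_row d w) a. Q (h @ w)})"
proof (rule card_Sigma_decomposition[where f = "\<lambda>w h. h @ w"])
  fix t assume t: "t \<in> {t \<in> Box d d a. Q t}"
  have w: "drop N t \<in> Box (d - N) d a"
    using t sorted_wrt_drop[of "(\<ge>)" t N] by (auto simp: Box_iff dest: in_set_dropD)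
  have "take N t @ drop N t \<in> Box (N + (d - N)) d a" using t assms(1) by simp
  then have "take N t \<in> Box N (next_row d (drop N t)) a"
    using Box_append[OF assms(2) w] by blast
  then show "\<exists>w\<in>Box (d - N) d a. \<exists>h\<in>{h \<in> Box N (next_row d w) a. Q (h @ w)}. t = h @ w"
    using t w by (intro bexI[of _ "drop N t"] bexI[of _ "take N t"]) auto
next
  fix w h assume "w \<in> Box (d - N) d a" "h \<in> {h \<in> Box N (next_row d w) a. Q (h @ w)}"
  then show "h @ w \<in> {t \<in> Box d d a. Q t}"
    using Box_append[OF assms(2), of w "d - N" h N] assms(1) by simp
next
  fix w h w' h'
  assume "w \<in> Box (d - N) d a" "h \<in> {h \<in> Box N (next_row d w) a. Q (h @ w)}"
    "w' \<in> Box (d - N) d a" "h' \<in> {h \<in> Box N (next_row d w') a. Q (h @ w')}" "h @ w = h' @ w'"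
  then show "w = w' \<and> h = h'" by (auto simp: Box_iff)
qed (auto simp: finite_Box)

lemma finite_squares_sum_le: "finite {r \<in> squares j d. sum_list r \<le> n}"
proof -
  have "finite_fibres (squares j d) sum_list" by (rule finite_fibres_squares) simp
  moreover have "{r \<in> squares j d. sum_list r \<le> n} = (\<Union>i\<le>n. {r \<in> squares j d. sum_list r = i})" by auto
  ultimately show ?thesis by (simp add: finite_fibres_def)
qed

text \<open>The bound \<open>sum_list r \<le> n\<close>, a consequence of \<open>Q (t @ r)\<close>,
  makes the index set finite.\<close>

lemma card_squares_split:
  assumes "\<And>xs. Q xs \<Longrightarrow> sum_list xs \<le> n"
  shows "card {xs \<in> squares (Suc j) a. Q xs}
    = (\<Sum>(d, r)\<in>(SIGMA d:{1..a}. {r \<in> squares j d. sum_list r \<le> n}).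
        card {t \<in> Box d d a. Q (t @ r)})"
proof -
  have "card {xs \<in> squares (Suc j) a. Q xs}
    = (\<Sum>p\<in>(SIGMA d:{1..a}. {r \<in> squares j d. sum_list r \<le> n}).
        card {t \<in> Box (fst p) (fst p) a. Q (t @ snd p)})"
  proof (rule card_Sigma_decomposition[where f = "\<lambda>p t. t @ snd p"])
    show "finite (SIGMA d:{1..a}. {r \<in> squares j d. sum_list r \<le> n})"
      by (intro finite_SigmaI finite_squares_sum_le) simp
  next
    fix p t assume "p \<in> (SIGMA d:{1..a}. {r \<in> squares j d. sum_list r \<le> n})"
      "t \<in> {t \<in> Box (fst p) (fst p) a. Q (t @ snd p)}"
    then show "t @ snd p \<in> {xs \<in> squares (Suc j) a. Q xs}"
      unfolding squares_Suc by force
  next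
    fix xs assume xs: "xs \<in> {xs \<in> squares (Suc j) a. Q xs}"
    then obtain d t r where
      *: "d \<in> {1..a}" "t \<in> Box d d a" "r \<in> squares j d" "xs = t @ r"
      unfolding squares_Suc by (elim CollectE conjE UN_E imageE SigmaE) auto
    have "sum_list r \<le> n" using assms[of xs] xs * by simp
    then show "\<exists>p\<in>SIGMA d:{1..a}. {r \<in> squares j d. sum_list r \<le> n}.
        \<exists>t\<in>{t \<in> Box (fst p) (fst p) a. Q (t @ snd p)}. xs = t @ snd p"
      using * xs by (intro bexI[of _ "(d, r)"] bexI[of _ t]) auto
  next
    fix p t p' t'
    assume "p \<in> (SIGMA d:{1..a}. {r \<in> squares j d. sum_list r \<le> n})"
      "t \<in> {t \<in> Box (fst p) (fst p) a. Q (t @ snd p)}"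
      "p' \<in> (SIGMA d:{1..a}. {r \<in> squares j d. sum_list r \<le> n})"
      "t' \<in> {t \<in> Box (fst p') (fst p') a. Q (t @ snd p')}" and eq: "t @ snd p = t' @ snd p'"
    then have m: "t \<in> Box (fst p) (fst p) a" "snd p \<in> Par 1 (fst p)"
      "t' \<in> Box (fst p') (fst p') a" "snd p' \<in> Par 1 (fst p')"
      by (auto simp: squares_def)
    have f: "fst p = fst p'" using Box_append_facts(1)[OF m(1,2)] Box_append_facts(1)[OF m(3,4)] eq by simp
    then have "length t = length t'" using m by (simp add: Box_iff)
    then show "p = p' \<and> t = t'" using eq f by (simp add: prod_eq_iff)
  qed (simp add: finite_Box)
  then show ?thesis by (simp add: case_prod_unfold)
qed

text \<open>By sortedness each column occupies an initial segment of the rows, so only the row of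
  index \<open>N\<close>, the (N+1)-st, decides.\<close>

lemma column_length_le_iff:
  assumes "sorted_wrt (\<ge>) xs"
  shows "column_length xs j \<le> N \<longleftrightarrow> length xs \<le> N \<or> xs ! N \<le> j"
proof -
  let ?S = "{i. i < length xs \<and> j < xs ! i}"
  have mono: "xs ! i' \<le> xs ! i" if "i \<le> i'" "i' < length xs" for i i'
    using assms that by (cases "i = i'") (auto simp: sorted_wrt_iff_nth_less)
  have cl: "column_length xs j = card ?S"
    by (simp add: column_length_def ferrers_def)
  show ?thesis
  proof
    assume L: "column_length xs j \<le> N"
    show "length xs \<le> N \<or> xs ! N \<le> j"
    proof (rule ccontr)
      assume "\<not> (length xs \<le> N \<or> xs ! N \<le> j)"
      then have "{..N} \<subseteq> ?S" using mono[of _ N] by fastforce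
      then have "card {..N} \<le> card ?S" by (intro card_mono) auto
      then show False using L cl by simp
    qed
  next
    assume R: "length xs \<le> N \<or> xs ! N \<le> j"
    have "?S \<subseteq> {..<N}"
    proof
      fix i assume i: "i \<in> ?S"
      show "i \<in> {..<N}"
      proof (rule ccontr)
        assume "i \<notin> {..<N}"
        then have "N \<le> i" by simp
        then show False using i R mono[of N i] by auto
      qed
    qed
    then have "card ?S \<le> card {..<N}" by (intro card_mono) auto
    then show "column_length xs j \<le> N" using cl by simp
  qed
qed

text \<open>The columns counted by the rank are those from \<open>next_row d w\<close> up to the end
  of the first row, so the rank sees the top rows \<open>h\<close> only through
  \<open>hd h\<close>.\<close>

lemma k_rank_append:
  assumes "h \<in> Box N (next_row d w) a" "w \<in> Box (d - N) d a" "r \<in> squares j d" "1 \<le> N" "N \<le> d" "d \<le> a"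
    "N = last_side j d r"
  shows "k_rank (Suc (Suc j)) ((h @ w) @ r) = int (hd h) - int (next_row d w) - int (excess j r)"
proof -
  let ?xs = "(h @ w) @ r"
  have t: "h @ w \<in> Box d d a" using Box_append[OF assms(6,2), of h N] assms by simp
  have rP: "r \<in> Par 1 d" using assms(3) by (simp add: squares_def)
  note f = Box_append_facts[OF t rP]
  have s1: "durfee_side 1 ?xs = d" using f(1) by (simp add: durfee_side_def below_durfee_0)
  have s2: "durfee_side (Suc j) ?xs = N" using f(3)[of j] assms(7) by (simp add: last_side_def)
  have b: "length (below_durfee (Suc j) ?xs) = excess j r" using f(2)[of j] by (simp add: excess_def)
  have so: "sorted_wrt (\<ge>) ?xs"
    using t rP by (auto simp: Box_iff Par_def sorted_wrt_append intro: order_trans)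
  have hne: "h \<noteq> []" using assms by (auto simp: Box_iff)
  have x0: "?xs ! 0 = hd h" using hne by (simp add: nth_append hd_conv_nth)
  have le: "?xs ! i \<le> hd h" if "i < length ?xs" for i
    using so[unfolded sorted_wrt_iff_nth_less, rule_format, of 0 i] that x0 by (cases "i = 0") auto
  have cols: "snd ` ferrers ?xs = {..<hd h}"
  proof (intro equalityI subsetI)
    fix c assume "c \<in> snd ` ferrers ?xs"
    then obtain i where "i < length ?xs" "c < ?xs ! i" unfolding ferrers_def by auto
    then show "c \<in> {..<hd h}" using le[of i] by simp
  next
    fix c assume "c \<in> {..<hd h}"
    then have "(0, c) \<in> ferrers ?xs" using x0 hne by (auto simp: ferrers_def)
    then show "c \<in> snd ` ferrers ?xs" by force
  qed
  have cond: "(d \<le> c \<and> column_length ?xs c \<le> N) \<longleftrightarrow> next_row d w \<le> c" for c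
  proof (cases "w = []")
    case True
    \<comment> \<open>Here the row of index \<open>N\<close>, if present, is the first part of
      \<open>r\<close>, hence at most \<open>d\<close>.\<close>
    then have "length h = N" "N = d" using assms by (auto simp: Box_iff)
    moreover have "r = [] \<or> r ! 0 \<le> d"
      using rP by (cases r) (auto simp: Par_def)
    ultimately show ?thesis using True
      unfolding column_length_le_iff[OF so] by (auto simp: next_row_def nth_append)
  next
    case False
    then have "?xs ! N = hd w" "length h = N" using assms by (auto simp: Box_iff nth_append hd_conv_nth)
    moreover have "d \<le> hd w" using False assms(2) by (auto simp: Box_iff)
    moreover have "N < length ?xs" using False \<open>length h = N\<close> by simp
    ultimately show ?thesis using False
      unfolding column_length_le_iff[OF so] by (auto simp: next_row_def)
  qed
  have "next_row d w \<le> hd h" using assms(1) hne by (auto simp: Box_iff)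
  moreover have "{c \<in> snd ` ferrers ?xs. durfee_side 1 ?xs \<le> c \<and>
      column_length ?xs c \<le> durfee_side (Suc (Suc j) - 1) ?xs} = {next_row d w..<hd h}"
    using s1 s2 cols cond by auto
  ultimately show ?thesis using b unfolding k_rank_def by simp
qed

text \<open>Everything except the top \<open>N\<close> rows of the first square is fixed, and
  \<open>card_top_rows\<close> is summed over the fixed data. The subtraction of the last side is
  moved to the left to stay within \<open>nat\<close>.\<close>

lemma card_k_rank:
  assumes "n < 2 * m" "n \<le> a"
  shows "card {xs \<in> squares (Suc j) a. sum_list xs = n \<and> k_rank (Suc (Suc j)) xs = int m}
    + card {xs \<in> squares (Suc j) a. sum_list xs + excess (Suc j) xs + last_side (Suc j) a xs + m = n}
    = card {xs \<in> squares (Suc j) a. sum_list xs + excess (Suc j) xs + m = n}"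
proof -
  let ?I = "SIGMA d:{1..a}. {r \<in> squares j d. sum_list r \<le> n}"
  have core: "card {t \<in> Box d d a. sum_list (t @ r) = n \<and> k_rank (Suc (Suc j)) (t @ r) = int m}
    + card {t \<in> Box d d a. sum_list (t @ r) + excess (Suc j) (t @ r) + last_side (Suc j) a (t @ r) + m = n}
    = card {t \<in> Box d d a. sum_list (t @ r) + excess (Suc j) (t @ r) + m = n}"
    if d: "1 \<le> d" "d \<le> a" and r: "r \<in> squares j d" for d r
  proof -
    define N where "N = last_side j d r"
    have N: "1 \<le> N" "N \<le> d" using last_side_bounds[OF d(1) r] by (auto simp: N_def)
    have rP: "r \<in> Par 1 d" using r by (simp add: squares_def)
    have hw: "card {h \<in> Box N (next_row d w) a. sum_list ((h @ w) @ r) = n \<and> k_rank (Suc (Suc j)) ((h @ w) @ r) = int m}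
      + card {h \<in> Box N (next_row d w) a. sum_list ((h @ w) @ r) + excess (Suc j) ((h @ w) @ r)
            + last_side (Suc j) a ((h @ w) @ r) + m = n}
      = card {h \<in> Box N (next_row d w) a. sum_list ((h @ w) @ r) + excess (Suc j) ((h @ w) @ r) + m = n}"
      if w: "w \<in> Box (d - N) d a" for w
    proof -
      define g where "g = next_row d w"
      \<comment> \<open>By \<open>k_rank_append\<close>, rank \<open>m\<close> means that the first
        row exceeds \<open>g\<close> by exactly this amount.\<close>
      define M where "M = m + excess j r"
      define e where "e = sum_list w + sum_list r"
      have hwB: "h @ w \<in> Box d d a" if "h \<in> Box N g a" for h
        using Box_append[OF d(2) w, of h N] that N g_def by simp
      have 1: "{h \<in> Box N g a. sum_list ((h @ w) @ r) = n \<and> k_rank (Suc (Suc j)) ((h @ w) @ r) = int m}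
        = {h \<in> Box N g a. sum_list h + e = n \<and> hd h = M + g}"
      proof (intro Collect_cong conj_cong refl)
        fix h assume "h \<in> Box N g a"
        then show "k_rank (Suc (Suc j)) ((h @ w) @ r) = int m \<longleftrightarrow> hd h = M + g"
          using k_rank_append[of h N d w a r j] w r N d by (auto simp: N_def g_def M_def)
      qed (auto simp: e_def)
      have 2: "{h \<in> Box N g a. sum_list ((h @ w) @ r) + excess (Suc j) ((h @ w) @ r)
            + last_side (Suc j) a ((h @ w) @ r) + m = n}
        = {h \<in> Box N g a. sum_list h + N + M + e = n}"
        by (intro Collect_cong conj_cong refl)
          (simp add: Box_append_facts(2,3)[OF hwB rP] N_def[symmetric] e_def M_def add_ac del: append_assoc)
      have 3: "{h \<in> Box N g a. sum_list ((h @ w) @ r) + excess (Suc j) ((h @ w) @ r) + m = n}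
        = {h \<in> Box N g a. sum_list h + M + e = n}"
        by (intro Collect_cong conj_cong refl)
          (simp add: Box_append_facts(2)[OF hwB rP] e_def M_def add_ac del: append_assoc)
      show ?thesis
      proof (cases "e \<le> n")
        case True
        then have "x + e = n \<longleftrightarrow> x = n - e" for x by auto
        moreover have "n - e < 2 * M" "n - e \<le> a" using assms by (auto simp: M_def)
        ultimately show ?thesis
          using card_top_rows[of N "n - e" a M g] N(1) unfolding g_def[symmetric] 1 2 3 by simp
      next
        case False
        then have "x + e \<noteq> n" for x by auto
        then show ?thesis unfolding g_def[symmetric] 1 2 3 by simp
      qed
    qed
    show ?thesis
      unfolding card_Box_split[OF N(2) d(2)] sum.distrib[symmetric]
      using hw by (intro sum.cong) auto
  qed
  have A: "card {xs \<in> squares (Suc j) a. sum_list xs = n \<and> k_rank (Suc (Suc j)) xs = int m}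
    = (\<Sum>(d, r)\<in>?I. card {t \<in> Box d d a. sum_list (t @ r) = n \<and> k_rank (Suc (Suc j)) (t @ r) = int m})"
    by (rule card_squares_split) auto
  have B: "card {xs \<in> squares (Suc j) a. sum_list xs + excess (Suc j) xs + last_side (Suc j) a xs + m = n}
    = (\<Sum>(d, r)\<in>?I. card {t \<in> Box d d a. sum_list (t @ r) + excess (Suc j) (t @ r) + last_side (Suc j) a (t @ r) + m = n})"
    by (rule card_squares_split) auto
  have C: "card {xs \<in> squares (Suc j) a. sum_list xs + excess (Suc j) xs + m = n}
    = (\<Sum>(d, r)\<in>?I. card {t \<in> Box d d a. sum_list (t @ r) + excess (Suc j) (t @ r) + m = n})"
    by (rule card_squares_split) auto
  show ?thesis
    unfolding A B C sum.distrib[symmetric]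
    using core by (intro sum.cong) (auto simp del: append_assoc sum_list_append)
qed

section \<open>Garvan's formula for \<open>k \<ge> 2\<close>\<close>

lemma partitions_of_eq:
  assumes "n \<le> a"
  shows "partitions_of (int n) = {xs \<in> Par 1 a. sum_list xs = n}"
proof -
  have "(0 \<notin> set xs) \<longleftrightarrow> (\<forall>x\<in>set xs. 1 \<le> x \<and> x \<le> a)" if "sum_list xs = n" for xs :: "nat list"
    using member_le_sum_list_nat[of _ xs] that assms by (metis le_trans less_one not_le)
  then show ?thesis by (auto simp: partitions_of_def Par_def)
qed

lemma num_partitions_eq_Par_gf: "n \<le> a \<Longrightarrow> int (num_partitions (int n)) = Par_gf 1 a $ n"
  by (simp add: num_partitions_def partitions_of_eq gf_nth)

lemma one_minus_X_mult_nth: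
  "1 \<le> n \<Longrightarrow> ((1 - fps_X) * F) $ n = F $ n - F $ (n - 1)" for F :: "int fps"
  by (cases n) (auto simp: left_diff_distrib)

lemma rank_count_eq_squares_gf:
  assumes "n < 2 * m" "m \<le> n"
  shows "int (rank_count (Suc (Suc j)) (int m) (int n)) = squares_gf (Suc j) n $ (n - m)"
proof -
  have shift: "x = n - m \<longleftrightarrow> x + m = n" for x using assms(2) by auto
  have "{xs \<in> partitions_of (int n). has_durfee_squares (Suc j) xs \<and> k_rank (Suc (Suc j)) xs = int m}
      = {xs \<in> squares (Suc j) n. sum_list xs = n \<and> k_rank (Suc (Suc j)) xs = int m}"
    using partitions_of_eq[of n n] by (auto simp: squares_def)
  then have "rank_count (Suc (Suc j)) (int m) (int n)
      = card {xs \<in> squares (Suc j) n. sum_list xs = n \<and> k_rank (Suc (Suc j)) xs = int m}"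
    by (simp add: rank_count_def)
  then show ?thesis
    using card_k_rank[OF assms(1) order_refl, of j]
    by (simp add: squares_gf_def gf_nth shift)
qed

text \<open>For k = j + 2 there are j + 1 squares, each contributing a factor q, so the coefficient
  at \<open>n - m\<close> becomes one at \<open>r\<close>.\<close>

lemma rank_count_ge_2:
  assumes "n < 2 * m" "m + Suc (Suc j) \<le> n"
  defines "r \<equiv> n - m - Suc j"
  shows "int (rank_count (Suc (Suc j)) (int m) (int n))
    = int (num_partitions (int r)) - int (num_partitions (int (r - 1)))"
proof -
  let ?F = "(1 - fps_X) * Par_gf 1 (Suc n)"
  have r: "1 \<le> r" "r < n" using assms by auto
  have "squares_gf (Suc j) n = fps_X ^ Suc j * (?F - fps_X ^ n * ?F)"
    unfolding squares_gf_eq_power_mult[of "Suc j"] squares_gf_0 by (simp only: left_diff_distrib mult_1_left mult.assoc)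
  moreover have "\<not> n - m < Suc j" using assms by simp
  ultimately have "squares_gf (Suc j) n $ (n - m) = (?F - fps_X ^ n * ?F) $ r"
    by (simp only: fps_X_power_mult_nth if_False r_def)
  \<comment> \<open>The term with \<open>fps_X ^ n\<close> starts beyond index
    \<open>r < n\<close>.\<close>
  also have "\<dots> = ?F $ r"
    using r by (simp only: fps_sub_nth fps_X_power_mult_nth if_True diff_zero)
  also have "\<dots> = Par_gf 1 (Suc n) $ r - Par_gf 1 (Suc n) $ (r - 1)"
    by (rule one_minus_X_mult_nth[OF r(1)])
  finally show ?thesis
    using rank_count_eq_squares_gf[of n m j] assms(1,2) r
      num_partitions_eq_Par_gf[of r "Suc n"] num_partitions_eq_Par_gf[of "r - 1" "Suc n"] by simp
qed

section \<open>The crank, \<open>k = 1\<close>\<close>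

lemma two_length_filter_le_sum_list:
  fixes xs :: "nat list"
  assumes "1 \<le> w"
  shows "2 * length (filter (\<lambda>x. w < x) xs) \<le> sum_list xs"
  using assms by (induction xs) auto

lemma crank_Cons:
  assumes "ys \<in> Par 2 a" "2 \<le> x" "\<forall>y\<in>set ys. y \<le> x"
  shows "crank (x # ys) = int x"
proof -
  have "count_list (x # ys) 1 = 0"
    using assms by (subst count_list_0_iff) (auto simp: Par_def)
  moreover have "Max (insert 0 (set (x # ys))) = x"
    using assms by (intro Max_eqI) auto
  ultimately show ?thesis by (simp add: crank_def Let_def)
qed

text \<open>If ones occur, the parts exceeding their number are at least 2 each, so the crank is at
  most n/2 < m. Hence there are no ones and \<open>m\<close> is the largest part. Conversely, parts
  summing to \<open>n - m < m\<close> can always follow \<open>m\<close>.\<close>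

lemma crank_partitions:
  assumes "n < 2 * m" "m < n"
  shows "{xs \<in> partitions_of (int n). crank xs = int m} = Cons m ` {ys \<in> Par 2 n. sum_list ys = n - m}"
    (is "?L = ?R")
proof (intro equalityI subsetI)
  fix xs assume xs: "xs \<in> ?L"
  then have P: "xs \<in> Par 1 n" "sum_list xs = n" using partitions_of_eq[of n n] by auto
  let ?w = "count_list xs 1"
  have w: "?w = 0"
  proof (rule ccontr)
    assume "?w \<noteq> 0"
    then have "int (length (filter (\<lambda>x. ?w < x) xs)) - int ?w = int m"
      using xs by (simp add: crank_def Let_def)
    then have "m \<le> length (filter (\<lambda>x. ?w < x) xs)" by linarith
    then show False
      using two_length_filter_le_sum_list[of ?w xs] \<open>?w \<noteq> 0\<close> P(2) assms(1) by linarith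
  qed
  then have mx: "Max (insert 0 (set xs)) = m" using xs by (simp add: crank_def Let_def)
  then obtain x ys where c: "xs = x # ys" using assms by (cases xs) auto
  have "Max (insert 0 (set xs)) = x"
    using P(1) c by (intro Max_eqI) (auto simp: Par_def)
  then have x: "x = m" using mx by simp
  have "1 \<notin> set xs" using w by (metis count_list_0_iff)
  then have "\<forall>y\<in>set ys. 2 \<le> y \<and> y \<le> n"
    using P(1) c by (force simp: Par_def numeral_2_eq_2 Suc_le_eq le_less)
  then show "xs \<in> ?R" using P x c by (auto simp: Par_def)
next
  fix xs assume "xs \<in> ?R"
  then obtain ys where ys: "xs = m # ys" "ys \<in> Par 2 n" "sum_list ys = n - m" by blast
  have le: "\<forall>y\<in>set ys. y \<le> m"
    using member_le_sum_list_nat[of _ ys] ys(3) assms by fastforce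
  have "crank xs = int m" using crank_Cons[OF ys(2) _ le] ys(1) assms by simp
  moreover have "xs \<in> partitions_of (int n)"
    using ys le assms unfolding partitions_of_def by (auto simp: Par_def)
  ultimately show "xs \<in> ?L" by simp
qed

lemma rank_count_1:
  assumes "n < 2 * m" "m < n"
  shows "int (rank_count 1 (int m) (int n))
    = int (num_partitions (int (n - m))) - int (num_partitions (int (n - m - 1)))"
proof -
  have "int (rank_count 1 (int m) (int n)) = int (card {ys \<in> Par 2 n. sum_list ys = n - m})"
    unfolding rank_count_def using crank_partitions[OF assms] by (simp add: card_image)
  also have "\<dots> = Par_gf (Suc 1) n $ (n - m)" by (simp add: gf_nth numeral_2_eq_2)
  also have "Par_gf (Suc 1) n = (1 - fps_X) * Par_gf 1 n"
    using Par_gf_Suc_left[of 1 n] assms by simp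
  also have "\<dots> $ (n - m) = Par_gf 1 n $ (n - m) - Par_gf 1 n $ (n - m - 1)"
    by (rule one_minus_X_mult_nth) (use assms in simp)
  finally show ?thesis
    using num_partitions_eq_Par_gf[of "n - m" n] num_partitions_eq_Par_gf[of "n - m - 1" n] by simp
qed

lemma rank_count_formula:
  assumes "0 < k" "n < 2 * m" "m + k \<le> n"
  shows "int (rank_count k (int m) (int n))
    = int (num_partitions (int (n - m - k + 1))) - int (num_partitions (int (n - m - k)))"
proof (cases "k = 1")
  case True
  then show ?thesis using rank_count_1[of n m] assms by simp
next
  case False
  then obtain j where "k = Suc (Suc j)" using assms(1) by (metis One_nat_def gr0_conv_Suc old.nat.exhaust)
  moreover have "n - m - Suc (Suc j) + 1 = n - m - Suc j" if "m + Suc (Suc j) \<le> n" using that by simp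
  ultimately show ?thesis using rank_count_ge_2[of n m j] assms by simp
qed

section \<open>The second difference of the partition function\<close>

text \<open>Raise the largest part by 1: \<open>1 \<le> i\<close> guarantees that there is one,
  \<open>i < a\<close> keeps it within the bound.\<close>

lemma Par_gf_mono:
  assumes "1 \<le> c" "1 \<le> i" "i < a"
  shows "Par_gf c a $ i \<le> Par_gf c a $ Suc i"
proof -
  let ?A = "\<lambda>i. {xs \<in> Par c a. sum_list xs = i}"
  have "card (?A i) \<le> card (?A (Suc i))"
  proof (rule card_inj_on_le[of "\<lambda>xs. Suc (hd xs) # tl xs"])
    have ne: "xs \<noteq> []" if "xs \<in> ?A i" for xs using that assms(2) by auto
    show "inj_on (\<lambda>xs. Suc (hd xs) # tl xs) (?A i)"
      using ne by (intro inj_onI) (metis list.collapse list.inject nat.inject)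
    show "(\<lambda>xs. Suc (hd xs) # tl xs) ` ?A i \<subseteq> ?A (Suc i)"
    proof
      fix ys assume "ys \<in> (\<lambda>xs. Suc (hd xs) # tl xs) ` ?A i"
      then obtain x xs where *: "x # xs \<in> ?A i" "ys = Suc x # xs"
        using ne by (metis (no_types, lifting) imageE list.collapse)
      moreover have "x \<le> i" using * by auto
      ultimately show "ys \<in> ?A (Suc i)" using assms(3) by (force simp: Par_def)
    qed
    show "finite (?A (Suc i))" using finite_fibres_Par[OF assms(1)] by (simp add: finite_fibres_def)
  qed
  then show ?thesis by (simp add: gf_nth)
qed

text \<open>For \<open>1 \<le> s\<close> this is the series q^s/(1 - q^s).\<close>

definition multiples :: "nat \<Rightarrow> int fps" where
  "multiples s = Abs_fps (\<lambda>j. if 0 < j \<and> s dvd j then 1 else 0)"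

lemma multiples_eq:
  assumes "1 \<le> s"
  shows "(1 - fps_X ^ s) * multiples s = fps_X ^ s"
proof (rule fps_ext)
  fix n
  have "s dvd n \<longleftrightarrow> s dvd n - s" if "s \<le> n"
    using that by (metis dvd_diff_nat dvd_refl le_add_diff_inverse dvd_add_right_iff)
  moreover have "n < s \<Longrightarrow> 0 < n \<Longrightarrow> \<not> s dvd n" by (simp add: nat_dvd_not_less)
  ultimately show "((1 - fps_X ^ s) * multiples s) $ n = (fps_X ^ s) $ n"
    using assms by (auto simp: left_diff_distrib fps_X_power_mult_nth multiples_def)
qed

lemma sum_multiples: "1 \<le> s \<Longrightarrow> (\<Sum>j\<le>x. multiples s $ j) = int (x div s)"
  by (induction x) (auto simp: multiples_def div_Suc dvd_eq_mod_eq_0)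

text \<open>Logarithmic differentiation: the factor 1/(1 - q^s) contributes s q^s/(1 - q^s). The
  induction multiplies by 1 - q^(a+1) instead of dividing.\<close>

lemma X_mult_deriv_Par_gf_3:
  assumes "2 \<le> a"
  shows "fps_X * fps_deriv (Par_gf 3 a) = Par_gf 3 a * (\<Sum>s\<in>{3..a}. fps_const (int s) * multiples s)"
  using assms
proof (induction a rule: dec_induct)
  case base
  show ?case by (simp add: Par_gf_empty)
next
  case (step a)
  let ?Q = "fps_X ^ Suc a :: int fps"
  let ?S = "\<lambda>a. \<Sum>s\<in>{3..a}. fps_const (int s) * multiples s"
  have r: "(1 - ?Q) * Par_gf 3 (Suc a) = Par_gf 3 a" by (rule Par_gf_Suc) (use step in auto)
  have Suc_a: "1 \<le> Suc a" by simp
  have S: "?S (Suc a) = ?S a + fps_const (int (Suc a)) * multiples (Suc a)" using step by simp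
  have dQ: "fps_X * fps_deriv ?Q = fps_const (int (Suc a)) * ?Q"
    unfolding fps_deriv_power by (simp add: mult_ac del: of_nat_Suc)
  have "(1 - ?Q) * (fps_X * fps_deriv (Par_gf 3 (Suc a)))
      = fps_X * fps_deriv ((1 - ?Q) * Par_gf 3 (Suc a)) + (fps_X * fps_deriv ?Q) * Par_gf 3 (Suc a)"
    by (simp only: fps_deriv_mult fps_deriv_sub fps_deriv_1) (simp add: algebra_simps)
  also have "\<dots> = Par_gf 3 a * ?S a + (fps_const (int (Suc a)) * ?Q) * Par_gf 3 (Suc a)"
    unfolding r step.IH dQ ..
  also have "\<dots> = (1 - ?Q) * Par_gf 3 (Suc a) * ?S a
      + fps_const (int (Suc a)) * ((1 - ?Q) * multiples (Suc a)) * Par_gf 3 (Suc a)"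
    unfolding r multiples_eq[OF Suc_a] ..
  also have "\<dots> = (1 - ?Q) * (Par_gf 3 (Suc a) * ?S (Suc a))"
    unfolding S by (simp only: distrib_left mult_ac)
  finally show ?case using one_minus_X_power_nonzero mult_cancel_left by blast
qed

text \<open>Summation by parts; it lets a bound on partial sums replace a bound on the single
  terms.\<close>

lemma sum_mult_antimono_nonneg:
  fixes \<gamma> g :: "nat \<Rightarrow> int"
  assumes "\<And>x. x \<le> n \<Longrightarrow> 0 \<le> (\<Sum>j\<le>x. \<gamma> j)" "\<And>j. j < n \<Longrightarrow> g (Suc j) \<le> g j"
  shows "g n * (\<Sum>j\<le>n. \<gamma> j) \<le> (\<Sum>j\<le>n. \<gamma> j * g j)"
  using assms
proof (induction n)
  case (Suc n)
  have "g (Suc n) * (\<Sum>j\<le>n. \<gamma> j) \<le> g n * (\<Sum>j\<le>n. \<gamma> j)"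
    using Suc.prems by (intro mult_right_mono) auto
  also have "\<dots> \<le> (\<Sum>j\<le>n. \<gamma> j * g j)" using Suc by auto
  finally show ?case by (simp add: algebra_simps)
qed simp

text \<open>The second factor is 1/((1 - q)(1 - q^2)), counting partitions into parts 1 and
  2.\<close>

lemma Par_gf_1_eq_Par_gf_3_mult:
  assumes "2 \<le> a"
  shows "Par_gf 1 a = Par_gf 3 a * Abs_fps (\<lambda>j. int (j div 2 + 1))" (is "_ = _ * ?K")
proof -
  have "(1 - fps_X) * ?K = Abs_fps (\<lambda>j. if even j then 1 else 0)" (is "_ = ?L")
  proof (rule fps_ext)
    fix j show "((1 - fps_X) * ?K) $ j = ?L $ j"
      by (cases j) (auto simp: left_diff_distrib elim!: oddE evenE)
  qed
  moreover have "(1 - fps_X ^ 2) * ?L = 1"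
  proof (rule fps_ext)
    fix j show "((1 - fps_X ^ 2) * ?L) $ j = 1 $ j"
      by (auto simp: left_diff_distrib fps_X_power_mult_nth less_2_cases_iff)
  qed
  ultimately have K: "(1 - fps_X ^ 2) * ((1 - fps_X) * ?K) = 1" by simp
  have "Par_gf 3 a * ?K = (1 - fps_X ^ 2) * ((1 - fps_X) * Par_gf 1 a) * ?K"
    using Par_gf_Suc_left[of 1 a] Par_gf_Suc_left[of 2 a] assms by (simp add: numeral_3_eq_3 numeral_2_eq_2)
  also have "\<dots> = Par_gf 1 a * ((1 - fps_X ^ 2) * ((1 - fps_X) * ?K))" by (simp only: mult_ac)
  finally show ?thesis unfolding K by simp
qed

text \<open>The constant is 12 = 4 + 8: the left side is at most 4 p(n) + \<sigma>(n), and
  \<sigma>(n) \<le> n^2 \<le> 8 p(n).\<close>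

lemma Par_gf_3_bounds:
  assumes "9 \<le> n"
  shows "int n * Par_gf 3 n $ n \<le> 12 * Par_gf 1 n $ n"
proof -
  define f where "f i = Par_gf 3 n $ i" for i
  \<comment> \<open>\<open>f\<close> drops from \<open>f 0 = 1\<close> to \<open>f 1 = 0\<close>.
    Resetting the value at 0 makes it monotone, at the cost of the extra term
    \<open>\<sigma> n\<close>.\<close>
  define f' where "f' i = (if i = 0 then 0 else f i)" for i
  define \<sigma> where "\<sigma> j = (\<Sum>s\<in>{3..n}. int s * multiples s $ j)" for j
  have f0: "f 0 = 1"
  proof -
    have "{xs \<in> Par 3 n. sum_list xs = 0} = {[]}"
      by (auto simp: Par_def sum_list_eq_0_iff) (metis list.set_intros(1) neq_Nil_conv not_numeral_le_zero)
    then show ?thesis by (simp add: f_def gf_nth)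
  qed
  have half: "2 * int j \<le> 4 * int (j div 2 + 1)" for j
  proof -
    have "j \<le> 2 * (j div 2 + 1)" by presburger
    then have "int j \<le> int (2 * (j div 2 + 1))" by (simp only: of_nat_le_iff)
    then show ?thesis by simp
  qed
  have f_nonneg: "0 \<le> f i" for i by (simp add: f_def gf_nth)
  have p_n: "Par_gf 1 n $ n = (\<Sum>j\<le>n. int (j div 2 + 1) * f (n - j))"
  proof -
    have "Par_gf 1 n $ n = (Abs_fps (\<lambda>j. int (j div 2 + 1)) * Par_gf 3 n) $ n"
      using Par_gf_1_eq_Par_gf_3_mult[of n] assms by (simp add: mult.commute)
    then show ?thesis by (simp add: fps_mult_nth f_def atMost_atLeast0)
  qed
  have f_pos: "1 \<le> f i" if "3 \<le> i" "i \<le> n" for i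
  proof -
    have "[i] \<in> {xs \<in> Par 3 n. sum_list xs = i}" using that by (simp add: Par_def)
    moreover have "finite {xs \<in> Par 3 n. sum_list xs = i}"
      using finite_fibres_Par[of 3 n] by (simp add: finite_fibres_def)
    ultimately have "0 < card {xs \<in> Par 3 n. sum_list xs = i}" by (metis card_gt_0_iff empty_iff)
    then show ?thesis by (simp add: f_def gf_nth)
  qed
  have \<sigma>_nonneg: "0 \<le> \<sigma> j" for j
    unfolding \<sigma>_def by (intro sum_nonneg) (simp add: multiples_def)
  \<comment> \<open>Each \<open>s \<le> x\<close> contributes
    \<open>s * (x div s) \<le> x\<close>.\<close>
  have \<sigma>_sum: "(\<Sum>j\<le>x. \<sigma> j) \<le> int x * int x" if "x \<le> n" for x
  proof -
    have "(\<Sum>j\<le>x. \<sigma> j) = (\<Sum>s\<in>{3..n}. int s * (\<Sum>j\<le>x. multiples s $ j))"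
      unfolding \<sigma>_def by (subst sum.swap) (simp add: sum_distrib_left)
    also have "\<dots> = (\<Sum>s\<in>{3..n}. int (s * (x div s)))"
      by (intro sum.cong) (auto simp: sum_multiples)
    also have "\<dots> \<le> (\<Sum>s\<in>{3..n}. if s \<le> x then int x else 0)"
      by (intro sum_mono) (auto simp del: of_nat_mult)
    also have "\<dots> = int (card {s \<in> {3..n}. s \<le> x}) * int x"
      by (simp add: sum.If_cases Int_def)
    also have "card {s \<in> {3..n}. s \<le> x} \<le> card {1..x}" by (intro card_mono) auto
    then have "int (card {s \<in> {3..n}. s \<le> x}) * int x \<le> int x * int x"
      by (intro mult_right_mono) auto
    finally show ?thesis .
  qed
  have "int n * f n = (fps_X * fps_deriv (Par_gf 3 n)) $ n"
    unfolding f_def using assms by (cases n) auto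
  also have "\<dots> = ((\<Sum>s\<in>{3..n}. fps_const (int s) * multiples s) * Par_gf 3 n) $ n"
    using X_mult_deriv_Par_gf_3[of n] assms by (simp add: mult.commute)
  also have "\<dots> = (\<Sum>j\<le>n. \<sigma> j * f (n - j))"
    by (subst fps_mult_nth) (simp add: fps_sum_nth \<sigma>_def f_def atMost_atLeast0)
  also have "\<dots> = (\<Sum>j\<le>n. \<sigma> j * f' (n - j)) + \<sigma> n"
  proof -
    obtain n' where n': "n = Suc n'" using assms by (cases n) auto
    have "(\<Sum>j\<le>n'. \<sigma> j * f (n - j)) = (\<Sum>j\<le>n'. \<sigma> j * f' (n - j))"
      using n' by (intro sum.cong) (auto simp: f'_def)
    then show ?thesis using n' by (simp add: f0 f'_def)
  qed
  also have "(\<Sum>j\<le>n. \<sigma> j * f' (n - j)) \<le> (\<Sum>j\<le>n. (2 * int j) * f' (n - j))"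
  proof -
    have gauss: "(\<Sum>j\<le>x. 2 * int j) = int x * (int x + 1)" for x
      by (induction x) (auto simp: algebra_simps)
    \<comment> \<open>Termwise, \<open>\<sigma> j \<le> 2 * j\<close> can fail (3 + 4 + 6 + 12 = 25
      at j = 12), but the partial sums of the difference are nonnegative.\<close>
    have "f' (n - n) * (\<Sum>j\<le>n. 2 * int j - \<sigma> j) \<le> (\<Sum>j\<le>n. (2 * int j - \<sigma> j) * f' (n - j))"
    proof (rule sum_mult_antimono_nonneg)
      fix x assume "x \<le> n"
      then show "0 \<le> (\<Sum>j\<le>x. 2 * int j - \<sigma> j)"
        using \<sigma>_sum[of x] gauss[of x] by (simp add: sum_subtractf algebra_simps)
    next
      fix j assume j: "j < n"
      show "f' (n - Suc j) \<le> f' (n - j)"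
      proof (cases "n - Suc j = 0")
        case True
        then show ?thesis using f_nonneg by (simp add: f'_def)
      next
        case False
        then have "f (n - Suc j) \<le> f (Suc (n - Suc j))"
          unfolding f_def using j by (intro Par_gf_mono) auto
        then show ?thesis using j f_nonneg by (simp add: f'_def Suc_diff_Suc)
      qed
    qed
    then show ?thesis by (simp add: f'_def left_diff_distrib sum_subtractf)
  qed
  also have "(\<Sum>j\<le>n. (2 * int j) * f' (n - j)) \<le> 4 * Par_gf 1 n $ n"
  proof -
    have p: "4 * Par_gf 1 n $ n = (\<Sum>j\<le>n. (4 * int (j div 2 + 1)) * f (n - j))"
      by (simp only: p_n sum_distrib_left mult.assoc)
    show ?thesis unfolding p
    proof (rule sum_mono)
      fix j
      show "2 * int j * f' (n - j) \<le> 4 * int (j div 2 + 1) * f (n - j)"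
        by (rule mult_mono[OF half]) (use f_nonneg in \<open>auto simp: f'_def\<close>)
    qed
  qed
  finally have 1: "int n * f n \<le> 4 * Par_gf 1 n $ n + \<sigma> n" by simp
  have "\<sigma> n \<le> (\<Sum>j\<le>n. \<sigma> j)" using \<sigma>_nonneg by (intro member_le_sum) auto
  then have 2: "\<sigma> n \<le> int n * int n" using \<sigma>_sum[of n] by simp
  have 3: "int n * int n \<le> 8 * Par_gf 1 n $ n"
  proof -
    \<comment> \<open>For \<open>j \<le> q\<close> the index \<open>n - j\<close> is at least 3,
      where \<open>f\<close> is positive.\<close>
    obtain q where q: "n = q + 3" using assms le_Suc_ex[of 3 n] by auto
    have "(\<Sum>j\<le>q. int (j div 2 + 1)) \<le> (\<Sum>j\<le>q. int (j div 2 + 1) * f (n - j))"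
    proof (rule sum_mono)
      fix j assume "j \<in> {..q}"
      then have "1 \<le> f (n - j)" using q by (intro f_pos) auto
      then have "int (j div 2 + 1) * 1 \<le> int (j div 2 + 1) * f (n - j)"
        by (intro mult_left_mono) auto
      then show "int (j div 2 + 1) \<le> int (j div 2 + 1) * f (n - j)" by simp
    qed
    also have "\<dots> \<le> (\<Sum>j\<le>n. int (j div 2 + 1) * f (n - j))"
      using f_nonneg q by (intro sum_mono2) auto
    also have "\<dots> = Par_gf 1 n $ n" by (rule p_n[symmetric])
    finally have "(\<Sum>j\<le>q. int (j div 2 + 1)) \<le> Par_gf 1 n $ n" .
    moreover have "int q * (int q + 1) \<le> 4 * (\<Sum>j\<le>x. int (j div 2 + 1))" if "x = q" for x
      unfolding that[symmetric]
    proof (induction x)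
      case (Suc x)
      have "2 * int (Suc x) \<le> 4 * int (Suc x div 2 + 1)" by (rule half)
      then show ?case using Suc by (simp add: algebra_simps)
    qed simp
    ultimately have "int q * (int q + 1) \<le> 4 * Par_gf 1 n $ n" by fastforce
    moreover have "int n * int n \<le> 2 * (int q * (int q + 1))"
    proof -
      \<comment> \<open>2q(q+1) - (q+3)^2 equals (q-6)(q+2) + 3; here \<open>9 \<le> n\<close>
        enters, as q \<ge> 6.\<close>
      have "0 \<le> (int q - 6) * (int q + 2)" using assms q by (intro mult_nonneg_nonneg) auto
      then show ?thesis using q by (simp add: algebra_simps)
    qed
    ultimately show ?thesis by linarith
  qed
  show ?thesis using 1 2 3 unfolding f_def by linarith
qed

text \<open>The first differences of \<open>p\<close> are coefficients of \<open>Par_gf 2 n\<close>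
  and increase. So the second difference is nonnegative and at most their two-step difference, a
  coefficient of \<open>Par_gf 3 n\<close>.\<close>

lemma second_difference_bounds:
  assumes "9 \<le> n"
  defines "p \<equiv> \<lambda>i. int (num_partitions (int i))"
  shows "0 \<le> p n - 2 * p (n - 1) + p (n - 2)"
    "int n * (p n - 2 * p (n - 1) + p (n - 2)) \<le> 12 * p n"
proof -
  have p: "p i = Par_gf 1 n $ i" if "i \<le> n" for i using num_partitions_eq_Par_gf[OF that] by (simp add: p_def)
  have d: "Par_gf 2 n $ i = p i - p (i - 1)" if "1 \<le> i" "i \<le> n" for i
    using Par_gf_Suc_left[of 1 n] one_minus_X_mult_nth[of i "Par_gf 1 n"] that p assms(1) by (simp add: numeral_2_eq_2)
  have "Par_gf 3 n = (1 - fps_X ^ 2) * Par_gf 2 n"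
    using Par_gf_Suc_left[of 2 n] assms(1) by (simp add: numeral_3_eq_3)
  then have f: "Par_gf 3 n $ n = Par_gf 2 n $ n - Par_gf 2 n $ (n - 2)"
    using assms(1) by (simp add: left_diff_distrib fps_X_power_mult_nth)
  have m1: "Par_gf 2 n $ (n - 1) \<le> Par_gf 2 n $ n" using Par_gf_mono[of 2 "n - 1" n] assms(1) by simp
  have m2: "Par_gf 2 n $ (n - 2) \<le> Par_gf 2 n $ (n - 1)"
    using Par_gf_mono[of 2 "n - 2" n] assms(1) by (simp add: Suc_diff_le numeral_2_eq_2 Suc_diff_Suc)
  have e: "p n - 2 * p (n - 1) + p (n - 2) = Par_gf 2 n $ n - Par_gf 2 n $ (n - 1)"
    using d[of n] d[of "n - 1"] assms(1) by (simp add: numeral_2_eq_2)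
  show "0 \<le> p n - 2 * p (n - 1) + p (n - 2)" using m1 e by simp
  have "int n * (p n - 2 * p (n - 1) + p (n - 2)) \<le> int n * Par_gf 3 n $ n"
    using e f m2 by (intro mult_left_mono) auto
  also have "\<dots> \<le> 12 * p n" using Par_gf_3_bounds[OF assms(1)] p[of n] by simp
  finally show "int n * (p n - 2 * p (n - 1) + p (n - 2)) \<le> 12 * p n" .
qed

section \<open>Comparison of the quotient with the exponentials\<close>

theorem theorem1p4:
  fixes k :: nat and m n :: int and l :: real
  assumes "k > 0"
    and "real_of_int m > real_of_int n / 2"
    and "l = real_of_int n - real k - real_of_int m + 23 / 24"
    and "l > 16"
  shows "\<exists>\<theta>1 \<theta>2 :: real.
    \<bar>\<theta>1\<bar> \<le> 2079 / l \<and> \<bar>\<theta>2\<bar> \<le> 3929 / l \<and>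
    (real (rank_count k m n) - real (rank_count k (m + 1) n))
        / real (num_partitions (n - int k - m + 1))
      = 1 + exp (- (sqrt 2 * pi / sqrt (3 * l))) * (1 + \<theta>1)
          - exp (- (pi / sqrt (6 * l))) * (2 + \<theta>2)"
proof -
  have "16 < real_of_int (n - int k - m + 1)" using assms(3,4) by simp
  then have big: "17 \<le> n - int k - m + 1" by linarith
  have nm: "n < 2 * m" using assms(2) by linarith
  define n' m' r where "n' = nat n" and "m' = nat m" and "r = nat (n - int k - m + 1)"
  have n': "n = int n'" and m': "m = int m'" and r: "n - int k - m + 1 = int r" "17 \<le> r"
    using big nm assms(1) by (auto simp: n'_def m'_def r_def)
  have l: "l = real r - 1 / 24"
  proof -
    have "real_of_int (n - int k - m + 1) = real r" using r by simp
    then show ?thesis using assms(3) by simp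
  qed
  define p where "p i = int (num_partitions (int i))" for i
  define e where "e = p r - 2 * p (r - 1) + p (r - 2)"
  have b1: "n' < 2 * m'" "m' + k + 2 \<le> n'" using nm big n' m' by auto
  have rn: "n' - m' - k = r - 1" "r - 1 + 1 = r" "n' - Suc m' - k = r - 2" "r - 2 + 1 = r - 1"
    using r b1 n' m' by auto
  have N1: "int (rank_count k m n) = p r - p (r - 1)"
    using rank_count_formula[of k n' m', unfolded rn] assms(1) b1 unfolding n' m' p_def by simp
  have m1: "m + 1 = int (Suc m')" using m' by simp
  have N2: "int (rank_count k (m + 1) n) = p (r - 1) - p (r - 2)"
    using rank_count_formula[of k n' "Suc m'", unfolded rn] assms(1) b1
    unfolding n' m1 p_def by simp
  have e0: "0 \<le> e" and e1: "int r * e \<le> 12 * p r"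
    using second_difference_bounds[of r] r(2) by (auto simp: e_def p_def)
  have ppos: "0 < p r"
  proof -
    have "[r] \<in> partitions_of (int r)" using r(2) by (simp add: partitions_of_def)
    moreover have "finite (partitions_of (int r))"
      using finite_fibres_Par[of 1 r] by (simp add: partitions_of_eq[of r r] finite_fibres_def)
    ultimately show ?thesis by (auto simp: p_def num_partitions_def card_gt_0_iff)
  qed
  define \<rho> where "\<rho> = real_of_int e / real_of_int (p r)"
  have ratio: "(real (rank_count k m n) - real (rank_count k (m + 1) n))
        / real (num_partitions (n - int k - m + 1)) = \<rho>"
  proof -
    have "real_of_int (int (rank_count k m n) - int (rank_count k (m + 1) n)) = real_of_int e"
      unfolding N1 N2 e_def by simp
    then show ?thesis by (simp add: \<rho>_def p_def r(1))
  qed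
  have lpos: "0 < l" using assms(4) by simp
  have rho0: "0 \<le> \<rho>" using e0 ppos by (simp add: \<rho>_def)
  have rho1: "\<rho> \<le> 12 / l"
  proof -
    have "real r * real_of_int e \<le> 12 * real_of_int (p r)"
      using e1 by (metis (mono_tags, opaque_lifting) of_int_le_iff of_int_mult of_int_numeral of_int_of_nat_eq)
    moreover have "l * real_of_int e \<le> real r * real_of_int e"
      using e0 l by (intro mult_right_mono) auto
    ultimately show ?thesis using ppos lpos by (simp add: \<rho>_def field_simps)
  qed
  \<comment> \<open>With \<open>x = exp (- B)\<close> the right-hand side is (1 - x)^2 up to the two
    error terms.\<close>
  define B where "B = pi / sqrt (6 * l)"
  define x where "x = exp (- B)"
  \<comment> \<open>6 * 16 = 96 exceeds 81, which yields \<open>B \<le> 1\<close> and later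
    \<open>exp B \<le> 3\<close>.\<close>
  have s96: "9 \<le> sqrt (6 * l)" by (rule real_le_rsqrt) (use assms(4) in simp)
  have B: "0 \<le> B" "B \<le> 1"
    using s96 pi_less_4 lpos by (auto simp: B_def divide_le_eq_1 lpos less_imp_le)
  have B2: "B\<^sup>2 \<le> 3 / l"
  proof -
    have "pi\<^sup>2 \<le> 4\<^sup>2" using pi_less_4 by (intro power_mono) auto
    then show ?thesis using lpos by (simp add: B_def power_divide field_simps)
  qed
  have two_B: "sqrt 2 * pi / sqrt (3 * l) = B + B"
  proof -
    have "sqrt (6 * l) = sqrt 2 * sqrt (3 * l)" by (simp flip: real_sqrt_mult)
    then show ?thesis using lpos by (simp add: B_def field_simps)
  qed
  have x1: "x \<le> 1" "1 - x \<le> B" using B exp_ge_add_one_self[of "- B"] by (auto simp: x_def)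
  then have "(1 - x)\<^sup>2 \<le> B\<^sup>2" by (intro power_mono) auto
  then have x2: "(1 - x)\<^sup>2 \<le> 3 / l" using B2 by linarith
  have "exp B \<le> exp 1" using B by simp
  then have e3: "exp B \<le> 3" using exp_le by linarith
  \<comment> \<open>Choosing \<theta>1 = 0, this is the solution of the equation for \<theta>2,
    since \<open>exp B\<close> is 1/x. Its size is at most 3 (3 + 12)/l = 45/l.\<close>
  define \<theta> where "\<theta> = exp B * ((1 - x)\<^sup>2 - \<rho>)"
  have "\<bar>(1 - x)\<^sup>2 - \<rho>\<bar> \<le> 15 / l"
  proof -
    have "0 \<le> (1 - x)\<^sup>2" by simp
    moreover have "15 / l = 3 / l + 12 / l" "0 \<le> 3 / l" "0 \<le> 12 / l"
      using lpos by (auto simp: field_simps)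
    ultimately show ?thesis using x2 rho0 rho1 by linarith
  qed
  then have "exp B * \<bar>(1 - x)\<^sup>2 - \<rho>\<bar> \<le> 3 * (15 / l)"
    using e3 by (intro mult_mono) auto
  also have "\<dots> \<le> 3929 / l" using lpos by (simp add: field_simps)
  finally have \<theta>: "\<bar>\<theta>\<bar> \<le> 3929 / l" by (simp add: \<theta>_def abs_mult)
  have xe: "x * exp B = 1" by (simp add: x_def flip: exp_add)
  have "x * \<theta> = (x * exp B) * ((1 - x)\<^sup>2 - \<rho>)" by (simp add: \<theta>_def)
  then have "x * \<theta> = (1 - x)\<^sup>2 - \<rho>" unfolding xe by simp
  then have "\<rho> = 1 + x * x * (1 + 0) - x * (2 + \<theta>)"
    by (simp add: algebra_simps power2_eq_square)
  moreover have "exp (- (sqrt 2 * pi / sqrt (3 * l))) = x * x"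
    unfolding two_B x_def by (simp flip: exp_add)
  ultimately have "\<rho> = 1 + exp (- (sqrt 2 * pi / sqrt (3 * l))) * (1 + 0)
      - exp (- (pi / sqrt (6 * l))) * (2 + \<theta>)"
    by (simp add: x_def B_def)
  then show ?thesis
    unfolding ratio using \<theta> lpos by (intro exI[of _ 0] exI[of _ \<theta>] conjI) simp_all
qed

end
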